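(* Let $S$ be an oriented smooth real hypersurface in $\mathbb{H}^2$. For a smooth function $f:S\to\mathbb{H}$ the following conditions are equivalent: (a) $f$ is a CRF function; (b) $f_{(\bar q_1)}\equiv f_{(\bar q_2)}\equiv 0$ on $S$; (c) $\mathrm{D}q_1|_S\wedge \mathrm{d}_{(q_1)}f\equiv \mathrm{D}q_2|_S\wedge \mathrm{d}_{(q_2)}f\equiv0$ on $S$.
   Context: Smooth means $C^\infty$. $\mathbb{H}$ is the quaternion algebra with real basis $\mathsf{i}_0=1,\mathsf{i}_1=\mathsf{i},\mathsf{i}_2=\mathsf{j},\mathsf{i}_3=\mathsf{k}$. Points of $\mathbb{H}^2\simeq\mathbb{R}^8$ are $(q_1,q_2)$, $q_1=\sum_{\alpha=0}^3 x_\alpha\mathsf{i}_\alpha$, $q_2=\sum_{\alpha=0}^3 y_\alpha\mathsf{i}_\alpha$. For a $C^1$ $\mathbb{H}$-valued function $F$ put $\frac{\partial F}{\partial\bar q_1}=\sum_\alpha\mathsf{i}_\alpha\frac{\partial F}{\partial x_\alpha}$, $\frac{\partial F}{\partial\bar q_2}=\sum_\alpha\mathsf{i}_\alpha\frac{\partial F}{\partial y_\alpha}$, $\overline{\mathfrak D}F=\big(\frac{\partial F}{\partial\bar q_1},\frac{\partial F}{\partial\bar q_2}\big)$. $S=\{\rho=0\}$, where $\rho$ is a smooth real function on an open set containing $S$ with $\nabla\rho\neq0$ on $S$. A smooth $f:S\to\mathbb{H}$ is a CRF function if it has a smooth extension $F$ to a neighborhood of $S$ with $\overline{\mathfrak D}F=\rho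 A+\overline{\mathfrak D}\rho\cdot B$, $A$ ($\mathbb{H}^2$-valued) and $B$ ($\mathbb{H}$-valued) smooth, where $\overline{\mathfrak D}\rho\cdot B=\big(\frac{\partial\rho}{\partial\bar q_1}B,\frac{\partial\rho}{\partial\bar q_2}B\big)$ (the condition is independent of $F$ and $\rho$). Forms: $dq_1=\sum\mathsf{i}_\alpha dx_\alpha$, $\overline{dq}_1=\sum\bar{\mathsf{i}}_\alpha dx_\alpha$, $dq_2=\sum\mathsf{i}_\alpha dy_\alpha$, $\overline{dq}_2=\sum\bar{\mathsf{i}}_\alpha dy_\alpha$, $dx=dx_0\wedge\dots\wedge dx_3$, $dy=dy_0\wedge\dots\wedge dy_3$, $\mathrm{D}q_1=\sum_\alpha(-1)^\alpha\mathsf{i}_\alpha\,dx_0\wedge\dots\wedge\widehat{dx_\alpha}\wedge\dots\wedge dx_3$, $\mathrm{D}q_2=\sum_\alpha(-1)^\alpha\mathsf{i}_\alpha\,dy_0\wedge\dots\wedge\widehat{dy_\alpha}\wedge\dots\wedge dy_3$. In wedge products of $\mathbb{H}$-valued forms the coefficients are multiplied in the written order. Let $\nu$ be the unit normal field giving the orientation of $S$, and $\omega$ the volume form of $S$ with $\omega=-\iota_\nu(dx\wedge dy)|_S$. For smooth $f:S\to\mathbb{H}$ define $f^\perp:S\to\mathbb{H}$ by $$-\tfrac12\big(\overline{dq}_1\wedge dq_1\wedge dy+dx\wedge\overline{dq}_2\wedge dq_2\big)\big|_S\wedge df=f^\perp\,\omega .$$ Let $\tau_{x_\alpha},\tau_{y_\alpha}$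 be the components of $\frac{\partial}{\partial x_\alpha},\frac{\partial}{\partial y_\alpha}$ tangential to $S$; put $f_{(x_\alpha)}=\tau_{x_\alpha}(f)+(\frac{\partial}{\partial x_\alpha},\nu)f^\perp$, $f_{(y_\alpha)}=\tau_{y_\alpha}(f)+(\frac{\partial}{\partial y_\alpha},\nu)f^\perp$, with $(\cdot,\cdot)$ the Euclidean scalar product of $\mathbb{R}^8$; $f_{(\bar q_1)}=\sum_\alpha\mathsf{i}_\alpha f_{(x_\alpha)}$, $f_{(\bar q_2)}=\sum_\alpha\mathsf{i}_\alpha f_{(y_\alpha)}$; and $\mathrm{d}_{(q_1)}f=\sum_\alpha f_{(x_\alpha)}dx_\alpha|_S$, $\mathrm{d}_{(q_2)}f=\sum_\alpha f_{(y_\alpha)}dy_\alpha|_S$. *)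

theory Defs
  imports "HOL-Analysis.Analysis"
begin

section \<open>The quaternion algebra\<close>

text \<open>
  The euclidean structure is the one for which \<open>1, i, j, k\<close> is orthonormal, so that
  \<open>quat \<times> quat\<close>, with the library's product structure, is the euclidean space \<open>\<real>\<^sup>8\<close>.
\<close>

datatype quat = Quat (qcoord0: real) (qcoord1: real) (qcoord2: real) (qcoord3: real)

lemma quat_eq_iff:
  "p = q \<longleftrightarrow> qcoord0 p = qcoord0 q \<and> qcoord1 p = qcoord1 q \<and> qcoord2 p = qcoord2 q \<and> qcoord3 p = qcoord3 q"
  by (cases p; cases q) simp

instantiation quat :: ring_1
begin

definition zero_quat :: quat where "0 = Quat 0 0 0 0"
definition one_quat :: quat where "1 = Quat 1 0 0 0"
definition plus_quat :: "quat \<Rightarrow> quat \<Rightarrow> quat" where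
  "p + q = Quat (qcoord0 p + qcoord0 q) (qcoord1 p + qcoord1 q) (qcoord2 p + qcoord2 q) (qcoord3 p + qcoord3 q)"
definition minus_quat :: "quat \<Rightarrow> quat \<Rightarrow> quat" where
  "p - q = Quat (qcoord0 p - qcoord0 q) (qcoord1 p - qcoord1 q) (qcoord2 p - qcoord2 q) (qcoord3 p - qcoord3 q)"
definition uminus_quat :: "quat \<Rightarrow> quat" where
  "- p = Quat (- qcoord0 p) (- qcoord1 p) (- qcoord2 p) (- qcoord3 p)"
definition times_quat :: "quat \<Rightarrow> quat \<Rightarrow> quat" where
  "p * q = Quat
    (qcoord0 p * qcoord0 q - qcoord1 p * qcoord1 q - qcoord2 p * qcoord2 q - qcoord3 p * qcoord3 q)
    (qcoord0 p * qcoord1 q + qcoord1 p * qcoord0 q + qcoord2 p * qcoord3 q - qcoord3 p * qcoord2 q)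
    (qcoord0 p * qcoord2 q - qcoord1 p * qcoord3 q + qcoord2 p * qcoord0 q + qcoord3 p * qcoord1 q)
    (qcoord0 p * qcoord3 q + qcoord1 p * qcoord2 q - qcoord2 p * qcoord1 q + qcoord3 p * qcoord0 q)"

instance
  by standard
    (simp_all add: quat_eq_iff zero_quat_def one_quat_def plus_quat_def minus_quat_def
      uminus_quat_def times_quat_def algebra_simps)

end

instantiation quat :: real_algebra_1
begin

definition scaleR_quat :: "real \<Rightarrow> quat \<Rightarrow> quat" where
  "r *\<^sub>R q = Quat (r * qcoord0 q) (r * qcoord1 q) (r * qcoord2 q) (r * qcoord3 q)"

instance
  by standard
    (simp_all add: quat_eq_iff plus_quat_def times_quat_def scaleR_quat_def algebra_simps)

end

instantiation quat :: real_inner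
begin

definition inner_quat :: "quat \<Rightarrow> quat \<Rightarrow> real" where
  "p \<bullet> q = qcoord0 p * qcoord0 q + qcoord1 p * qcoord1 q + qcoord2 p * qcoord2 q + qcoord3 p * qcoord3 q"
definition norm_quat :: "quat \<Rightarrow> real" where "norm (q :: quat) = sqrt (q \<bullet> q)"
definition sgn_quat :: "quat \<Rightarrow> quat" where "sgn (q :: quat) = q /\<^sub>R norm q"
definition dist_quat :: "quat \<Rightarrow> quat \<Rightarrow> real" where "dist p (q :: quat) = norm (p - q)"
definition uniformity_quat :: "(quat \<times> quat) filter" where
  "uniformity = (INF e\<in>{0 <..}. principal {(x, y :: quat). dist x y < e})"
definition open_quat :: "quat set \<Rightarrow> bool" where
  "open U \<longleftrightarrow> (\<forall>x\<in>U. eventually (\<lambda>(x', y :: quat). x' = x \<longrightarrow> y \<in> U) uniformity)"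

instance
proof
  fix p q r :: quat and a :: real and U :: "quat set"
  show "dist p q = norm (p - q)" by (rule dist_quat_def)
  show "sgn p = p /\<^sub>R norm p" by (rule sgn_quat_def)
  show "uniformity = (INF e\<in>{0 <..}. principal {(x, y :: quat). dist x y < e})"
    by (rule uniformity_quat_def)
  show "open U \<longleftrightarrow> (\<forall>x\<in>U. eventually (\<lambda>(x', y). x' = x \<longrightarrow> y \<in> U) uniformity)"
    by (rule open_quat_def)
  show "norm p = sqrt (p \<bullet> p)" by (rule norm_quat_def)
  show "p \<bullet> p = 0 \<longleftrightarrow> p = 0"
    by (auto simp: quat_eq_iff inner_quat_def zero_quat_def add_nonneg_eq_0_iff
        simp flip: power2_eq_square)
qed (simp_all add: inner_quat_def plus_quat_def scaleR_quat_def algebra_simps)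

end

instance quat :: real_normed_algebra_1
proof
  fix p q :: quat
  have "(p * q) \<bullet> (p * q) = (p \<bullet> p) * (q \<bullet> q)"
    unfolding inner_quat_def times_quat_def quat.sel by (simp add: algebra_simps)
  then show "norm (p * q) \<le> norm p * norm q"
    by (simp add: norm_quat_def real_sqrt_mult)
  show "norm (1 :: quat) = 1"
    by (simp add: norm_quat_def inner_quat_def one_quat_def)
qed

definition iunit :: "nat \<Rightarrow> quat" where
  "iunit \<alpha> = [Quat 1 0 0 0, Quat 0 1 0 0, Quat 0 0 1 0, Quat 0 0 0 1] ! \<alpha>"

definition qcnj :: "quat \<Rightarrow> quat" where
  "qcnj q = Quat (qcoord0 q) (- qcoord1 q) (- qcoord2 q) (- qcoord3 q)"

instantiation quat :: euclidean_space
begin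

definition Basis_quat :: "quat set" where "Basis = iunit ` {..<4}"

instance
proof
  have B: "Basis = {Quat 1 0 0 0, Quat 0 1 0 0, Quat 0 0 1 0, Quat 0 0 0 1}"
    by (simp add: Basis_quat_def iunit_def eval_nat_numeral lessThan_Suc insert_commute)
  show "(Basis :: quat set) \<noteq> {}" "finite (Basis :: quat set)"
    by (simp_all add: B)
  show "u \<bullet> v = (if u = v then 1 else 0)" if "u \<in> Basis" "v \<in> Basis" for u v :: quat
    using that unfolding B by (elim insertE emptyE; simp add: inner_quat_def)
  show "(\<forall>u\<in>Basis. x \<bullet> u = 0) \<longleftrightarrow> x = 0" for x :: quat
    unfolding B by (cases x) (simp add: inner_quat_def zero_quat_def)
qed

end


section \<open>Smooth functions and hypersurfaces\<close>

text \<open>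
  The domain is finite-dimensional, so continuity of all iterated directional derivatives is the
  usual notion of \<open>C\<^sup>k\<close>. These predicates are meant for open sets.
\<close>

primrec Ck_on :: "nat \<Rightarrow> 'a::euclidean_space set \<Rightarrow> ('a \<Rightarrow> 'b::real_normed_vector) \<Rightarrow> bool" where
  "Ck_on 0 = (\<lambda>V F. continuous_on V F)"
| "Ck_on (Suc k) = (\<lambda>V F. F differentiable_on V \<and>
     (\<forall>v. Ck_on k V (\<lambda>z. frechet_derivative F (at z) v)))"

definition smooth_on :: "'a::euclidean_space set \<Rightarrow> ('a \<Rightarrow> 'b::real_normed_vector) \<Rightarrow> bool" where
  "smooth_on V F \<longleftrightarrow> (\<forall>k. Ck_on k V F)"

text \<open>Functions on \<open>S\<close> are total functions of which only the values on \<open>S\<close> matter.\<close>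

definition smooth_on_surface ::
    "'a::euclidean_space set \<Rightarrow> ('a \<Rightarrow> 'b::real_normed_vector) \<Rightarrow> bool" where
  "smooth_on_surface S f \<longleftrightarrow>
     (\<forall>p\<in>S. \<exists>W F. open W \<and> p \<in> W \<and> smooth_on W F \<and> (\<forall>z\<in>S \<inter> W. F z = f z))"

definition gradient :: "('a::euclidean_space \<Rightarrow> real) \<Rightarrow> 'a \<Rightarrow> 'a" where
  "gradient \<rho> p = (\<Sum>b\<in>Basis. frechet_derivative \<rho> (at p) b *\<^sub>R b)"

definition defining_function ::
    "'a::euclidean_space set \<Rightarrow> ('a \<Rightarrow> real) \<Rightarrow> 'a set \<Rightarrow> bool" where
  "defining_function U \<rho> S \<longleftrightarrow> open U \<and> smooth_on U \<rho> \<and> S = {p \<in> U. \<rho> p = 0} \<and>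
     (\<forall>p\<in>S. gradient \<rho> p \<noteq> 0)"

definition tangent_space :: "('a::euclidean_space \<Rightarrow> real) \<Rightarrow> 'a \<Rightarrow> 'a set" where
  "tangent_space \<rho> p = {v. frechet_derivative \<rho> (at p) v = 0}"

text \<open>
  An orientation of \<open>S\<close> is given by a continuous unit normal field \<open>\<nu>\<close>; on each component of \<open>S\<close>
  it is one of the two fields \<open>\<plusminus> gradient \<rho> / norm (gradient \<rho>)\<close>.
\<close>

definition unit_normal_field ::
    "('a::euclidean_space \<Rightarrow> real) \<Rightarrow> 'a set \<Rightarrow> ('a \<Rightarrow> 'a) \<Rightarrow> bool" where
  "unit_normal_field \<rho> S \<nu> \<longleftrightarrow> continuous_on S \<nu> \<and>
     (\<forall>p\<in>S. norm (\<nu> p) = 1 \<and> (\<forall>v\<in>tangent_space \<rho> p. \<nu> p \<bullet> v = 0))"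


section \<open>CRF functions\<close>

type_synonym qpoint = "quat \<times> quat"

definition ddx :: "nat \<Rightarrow> qpoint" where "ddx \<alpha> = (iunit \<alpha>, 0)"
definition ddy :: "nat \<Rightarrow> qpoint" where "ddy \<alpha> = (0, iunit \<alpha>)"

definition dbar :: "(qpoint \<Rightarrow> quat) \<Rightarrow> qpoint \<Rightarrow> quat \<times> quat" where
  "dbar F z = ((\<Sum>\<alpha><4. iunit \<alpha> * frechet_derivative F (at z) (ddx \<alpha>)),
               (\<Sum>\<alpha><4. iunit \<alpha> * frechet_derivative F (at z) (ddy \<alpha>)))"

definition crf_function ::
    "qpoint set \<Rightarrow> (qpoint \<Rightarrow> real) \<Rightarrow> qpoint set \<Rightarrow> (qpoint \<Rightarrow> quat) \<Rightarrow> bool" where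
  "crf_function U \<rho> S f \<longleftrightarrow>
     (\<exists>V F A B. open V \<and> S \<subseteq> V \<and> V \<subseteq> U \<and> smooth_on V F \<and> (\<forall>z\<in>S. F z = f z) \<and>
        smooth_on V (A :: qpoint \<Rightarrow> quat \<times> quat) \<and> smooth_on V (B :: qpoint \<Rightarrow> quat) \<and>
        (\<forall>z\<in>V. dbar F z = \<rho> z *\<^sub>R A z +
           (let R = dbar (\<lambda>w. of_real (\<rho> w)) z in (fst R * B z, snd R * B z))))"


section \<open>Quaternion-valued exterior forms\<close>

text \<open>
  An element of the (total) algebra of \<open>quat\<close>-valued exterior forms is a function on lists of
  vectors; its component of degree \<open>k\<close> is its restriction to lists of length \<open>k\<close>.
  The wedge product is the shuffle formula, normalised by
  \<open>(\<phi> \<and> \<psi>)(u, v) = \<phi>(u) \<psi>(v) - \<phi>(v) \<psi>(u)\<close> for 1-forms; the coefficients are multiplied in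
  the written order. \<open>I\<close> is the set of positions of the arguments passed to the left factor, and the
  sign is that of the corresponding shuffle.
\<close>

type_synonym 'v qform = "'v list \<Rightarrow> quat"

definition shuffle_sign :: "nat \<Rightarrow> nat set \<Rightarrow> quat" where
  "shuffle_sign n I = (- 1) ^ card {(j, i). j < i \<and> i < n \<and> i \<in> I \<and> j \<notin> I}"

definition wedge :: "'v qform \<Rightarrow> 'v qform \<Rightarrow> 'v qform" (infixl \<open>\<and>\<^sub>q\<close> 70) where
  "(\<phi> \<and>\<^sub>q \<psi>) vs = (\<Sum>I\<in>Pow {..<length vs}. shuffle_sign (length vs) I * (\<phi> (nths vs I) * \<psi> (nths vs (- I))))"

definition one_form :: "('v \<Rightarrow> quat) \<Rightarrow> 'v qform" where
  "one_form \<phi> vs = (case vs of [v] \<Rightarrow> \<phi> v | _ \<Rightarrow> 0)"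

definition dx :: "nat \<Rightarrow> qpoint qform" where "dx \<alpha> = one_form (\<lambda>v. of_real (v \<bullet> ddx \<alpha>))"
definition dy :: "nat \<Rightarrow> qpoint qform" where "dy \<alpha> = one_form (\<lambda>v. of_real (v \<bullet> ddy \<alpha>))"

definition dx_vol :: "qpoint qform" where "dx_vol = dx 0 \<and>\<^sub>q dx 1 \<and>\<^sub>q dx 2 \<and>\<^sub>q dx 3"
definition dy_vol :: "qpoint qform" where "dy_vol = dy 0 \<and>\<^sub>q dy 1 \<and>\<^sub>q dy 2 \<and>\<^sub>q dy 3"

definition dq1 :: "qpoint qform" where "dq1 vs = (\<Sum>\<alpha><4. iunit \<alpha> * dx \<alpha> vs)"
definition dq2 :: "qpoint qform" where "dq2 vs = (\<Sum>\<alpha><4. iunit \<alpha> * dy \<alpha> vs)"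
definition cdq1 :: "qpoint qform" where "cdq1 vs = (\<Sum>\<alpha><4. qcnj (iunit \<alpha>) * dx \<alpha> vs)"
definition cdq2 :: "qpoint qform" where "cdq2 vs = (\<Sum>\<alpha><4. qcnj (iunit \<alpha>) * dy \<alpha> vs)"

definition Dq1 :: "qpoint qform" where
  "Dq1 vs = iunit 0 * (dx 1 \<and>\<^sub>q dx 2 \<and>\<^sub>q dx 3) vs - iunit 1 * (dx 0 \<and>\<^sub>q dx 2 \<and>\<^sub>q dx 3) vs
          + iunit 2 * (dx 0 \<and>\<^sub>q dx 1 \<and>\<^sub>q dx 3) vs - iunit 3 * (dx 0 \<and>\<^sub>q dx 1 \<and>\<^sub>q dx 2) vs"
definition Dq2 :: "qpoint qform" where
  "Dq2 vs = iunit 0 * (dy 1 \<and>\<^sub>q dy 2 \<and>\<^sub>q dy 3) vs - iunit 1 * (dy 0 \<and>\<^sub>q dy 2 \<and>\<^sub>q dy 3) vs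
          + iunit 2 * (dy 0 \<and>\<^sub>q dy 1 \<and>\<^sub>q dy 3) vs - iunit 3 * (dy 0 \<and>\<^sub>q dy 1 \<and>\<^sub>q dy 2) vs"

text \<open>Equality after restriction to a subspace \<open>T\<close> (below, a tangent space of \<open>S\<close>).\<close>

definition form_eq_on :: "'v set \<Rightarrow> 'v qform \<Rightarrow> 'v qform \<Rightarrow> bool" where
  "form_eq_on T \<phi> \<psi> \<longleftrightarrow> (\<forall>vs\<in>lists T. \<phi> vs = \<psi> vs)"


section \<open>Derivatives of functions on the hypersurface\<close>

text \<open>
  \<open>frechet_derivative f (at p within S)\<close> is some linear map approximating \<open>f\<close> along \<open>S\<close>; only its
  values on \<open>tangent_space \<rho> p\<close> are determined (they are those of the derivative of any local
  extension of \<open>f\<close>), and \<open>surface_diff\<close> is applied to tangent vectors only.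
\<close>

definition surface_diff :: "qpoint set \<Rightarrow> (qpoint \<Rightarrow> quat) \<Rightarrow> qpoint \<Rightarrow> qpoint \<Rightarrow> quat" where
  "surface_diff S f p v = frechet_derivative f (at p within S) v"

text \<open>The volume form \<open>- \<iota>\<^sub>\<nu> (dx \<and> dy)\<close>, \<open>n\<close> being the value of \<open>\<nu>\<close> at the point.\<close>

definition surface_vol :: "qpoint \<Rightarrow> qpoint qform" where
  "surface_vol n vs = - (dx_vol \<and>\<^sub>q dy_vol) (n # vs)"

definition f_perp :: "(qpoint \<Rightarrow> real) \<Rightarrow> qpoint set \<Rightarrow> (qpoint \<Rightarrow> qpoint) \<Rightarrow>
    (qpoint \<Rightarrow> quat) \<Rightarrow> qpoint \<Rightarrow> quat" where
  "f_perp \<rho> S \<nu> f p = (THE c. form_eq_on (tangent_space \<rho> p)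
     ((\<lambda>vs. (- 1 / 2) *\<^sub>R ((cdq1 \<and>\<^sub>q dq1 \<and>\<^sub>q dy_vol) vs + (dx_vol \<and>\<^sub>q cdq2 \<and>\<^sub>q dq2) vs))
        \<and>\<^sub>q one_form (surface_diff S f p))
     (\<lambda>vs. c * surface_vol (\<nu> p) vs))"

text \<open>\<open>f_along \<dots> e p\<close> is \<open>f\<^bsub>(x\<^sub>\<alpha>)\<^esub>\<close> or \<open>f\<^bsub>(y\<^sub>\<alpha>)\<^esub>\<close> at \<open>p\<close>, for \<open>e\<close> the respective coordinate vector.\<close>

definition f_along :: "(qpoint \<Rightarrow> real) \<Rightarrow> qpoint set \<Rightarrow> (qpoint \<Rightarrow> qpoint) \<Rightarrow>
    (qpoint \<Rightarrow> quat) \<Rightarrow> qpoint \<Rightarrow> qpoint \<Rightarrow> quat" where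
  "f_along \<rho> S \<nu> f e p =
     surface_diff S f p (e - (e \<bullet> \<nu> p) *\<^sub>R \<nu> p) + (e \<bullet> \<nu> p) *\<^sub>R f_perp \<rho> S \<nu> f p"

definition f_qbar1 :: "(qpoint \<Rightarrow> real) \<Rightarrow> qpoint set \<Rightarrow> (qpoint \<Rightarrow> qpoint) \<Rightarrow>
    (qpoint \<Rightarrow> quat) \<Rightarrow> qpoint \<Rightarrow> quat" where
  "f_qbar1 \<rho> S \<nu> f p = (\<Sum>\<alpha><4. iunit \<alpha> * f_along \<rho> S \<nu> f (ddx \<alpha>) p)"

definition f_qbar2 :: "(qpoint \<Rightarrow> real) \<Rightarrow> qpoint set \<Rightarrow> (qpoint \<Rightarrow> qpoint) \<Rightarrow>
    (qpoint \<Rightarrow> quat) \<Rightarrow> qpoint \<Rightarrow> quat" where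
  "f_qbar2 \<rho> S \<nu> f p = (\<Sum>\<alpha><4. iunit \<alpha> * f_along \<rho> S \<nu> f (ddy \<alpha>) p)"

definition d_q1 :: "(qpoint \<Rightarrow> real) \<Rightarrow> qpoint set \<Rightarrow> (qpoint \<Rightarrow> qpoint) \<Rightarrow>
    (qpoint \<Rightarrow> quat) \<Rightarrow> qpoint \<Rightarrow> qpoint qform" where
  "d_q1 \<rho> S \<nu> f p vs = (\<Sum>\<alpha><4. f_along \<rho> S \<nu> f (ddx \<alpha>) p * dx \<alpha> vs)"

definition d_q2 :: "(qpoint \<Rightarrow> real) \<Rightarrow> qpoint set \<Rightarrow> (qpoint \<Rightarrow> qpoint) \<Rightarrow>
    (qpoint \<Rightarrow> quat) \<Rightarrow> qpoint \<Rightarrow> qpoint qform" where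
  "d_q2 \<rho> S \<nu> f p vs = (\<Sum>\<alpha><4. f_along \<rho> S \<nu> f (ddy \<alpha>) p * dy \<alpha> vs)"

end

theory Submission
  imports Defs
begin

text \<open>
  At a point of \<open>S\<close> let \<open>n = \<nu> p\<close>, let \<open>L\<close> be the derivative of a local extension of \<open>f\<close> and
  \<open>D = (\<Sum> i\<^sub>\<alpha> L(\<partial>x\<^sub>\<alpha>), \<Sum> i\<^sub>\<alpha> L(\<partial>y\<^sub>\<alpha>))\<close>. Since the wedge of the conjugate of \<open>dq\<close> with \<open>dq\<close> is
  anti-self-dual, the 7-form defining \<open>f\<^sup>\<bottom>\<close> is a contraction of the volume form, and \<open>f\<^sup>\<bottom> = L n - \<langle>n, D\<rangle>\<close> for the
  quaternionic hermitian product. Hence \<open>(f\<^sub>1, f\<^sub>2) = D - n \<langle>n, D\<rangle>\<close>, the pair in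
  (b), is the projection of \<open>D\<close> to the
  orthogonal complement of the quaternionic line spanned by \<open>n\<close>, and (b) says that \<open>D\<close> is a multiple of the
  normal vector. For (c), \<open>Dq\<^sub>1 \<and> d\<^sub>1 f = - f\<^sub>1 dx\<close>, and \<open>dx\<close> vanishes on the tangent space only if
  \<open>n\<^sub>2 = 0\<close>, in which case \<open>\<langle>n, (f\<^sub>1, f\<^sub>2)\<rangle> = 0\<close> gives \<open>f\<^sub>1 = 0\<close>. For the implication from (b) to (a), \<open>f\<close> is
  extended by a partition of unity, \<open>B\<close> is the coefficient of \<open>D\<close> along the gradient of \<open>\<rho>\<close>, and the
  remainder vanishes on \<open>S\<close>, so that it is divisible by \<open>\<rho>\<close> (Hadamard's lemma).
\<close>

section \<open>The ring of quaternion-valued exterior forms\<close>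

text \<open>The exponent counts inversions. As position 0 goes to the right factor, it forms one
  inversion with each element of \<open>I\<close>; all the others come from the remaining positions,
  shifted down by one.\<close>

lemma shuffle_sign_Suc_not_in:
  assumes "0 \<notin> I" "I \<subseteq> {..<Suc n}"
  shows "shuffle_sign (Suc n) I = (- 1) ^ card I * shuffle_sign n {j. Suc j \<in> I}"
proof -
  let ?A = "{(j, i). j < i \<and> i < Suc n \<and> i \<in> I \<and> j \<notin> I}"
  let ?B = "{(j, i). j < i \<and> i < n \<and> Suc i \<in> I \<and> Suc j \<notin> I}"
  have "?A = (\<lambda>i. (0, i)) ` I \<union> (\<lambda>(j, i). (Suc j, Suc i)) ` ?B"
  proof (intro set_eqI iffI)
    fix p assume "p \<in> ?A"
    then obtain j i where p: "p = (j, i)" "j < i" "i < Suc n" "i \<in> I" "j \<notin> I" by blast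
    show "p \<in> (\<lambda>i. (0, i)) ` I \<union> (\<lambda>(j, i). (Suc j, Suc i)) ` ?B"
    proof (cases j)
      case 0 then show ?thesis using p by blast
    next
      case (Suc j')
      then obtain i' where "i = Suc i'" using p by (cases i) auto
      then have "p = (\<lambda>(j, i). (Suc j, Suc i)) (j', i')" "(j', i') \<in> ?B" using p Suc by auto
      then show ?thesis by blast
    qed
  next
    fix p assume "p \<in> (\<lambda>i. (0, i)) ` I \<union> (\<lambda>(j, i). (Suc j, Suc i)) ` ?B"
    then show "p \<in> ?A"
      using assms by (auto intro: Nat.gr0I)
  qed
  moreover have "finite I" using assms(2) finite_subset by blast
  moreover have "finite ?B" by (rule finite_subset[of _ "{..n} \<times> {..n}"]) auto
  moreover have "(\<lambda>i. (0, i)) ` I \<inter> (\<lambda>(j, i). (Suc j, Suc i)) ` ?B = {}" by auto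
  ultimately have "card ?A = card ((\<lambda>i. (0::nat, i)) ` I) + card ((\<lambda>(j, i). (Suc j, Suc i)) ` ?B)"
    by (simp add: card_Un_disjoint)
  also have "\<dots> = card I + card ?B"
    by (intro arg_cong2[where f = "(+)"] card_image) (auto simp: inj_on_def)
  finally show ?thesis
    by (simp add: shuffle_sign_def power_add)
qed

text \<open>Position 0 goes to the left factor and no position precedes it, so it occurs in no
  inversion.\<close>

lemma shuffle_sign_Suc_in:
  assumes "0 \<in> I"
  shows "shuffle_sign (Suc n) I = shuffle_sign n {j. Suc j \<in> I}"
proof -
  let ?A = "{(j, i). j < i \<and> i < Suc n \<and> i \<in> I \<and> j \<notin> I}"
  let ?B = "{(j, i). j < i \<and> i < n \<and> Suc i \<in> I \<and> Suc j \<notin> I}"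
  have "?A = (\<lambda>(j, i). (Suc j, Suc i)) ` ?B"
  proof (intro set_eqI iffI)
    fix p assume "p \<in> ?A"
    then obtain j i where p: "p = (j, i)" "j < i" "i < Suc n" "i \<in> I" "j \<notin> I" by blast
    then obtain j' i' where "j = Suc j'" "i = Suc i'" using assms by (cases i; cases j) auto
    then have "p = (\<lambda>(j, i). (Suc j, Suc i)) (j', i')" "(j', i') \<in> ?B" using p by auto
    then show "p \<in> (\<lambda>(j, i). (Suc j, Suc i)) ` ?B" by blast
  qed auto
  then have "card ?A = card ?B"
    by (simp add: card_image inj_on_def)
  then show ?thesis by (simp add: shuffle_sign_def)
qed

lemma wedge_Nil [simp]: "(\<phi> \<and>\<^sub>q \<psi>) [] = \<phi> [] * \<psi> []"
  by (simp add: wedge_def shuffle_sign_def)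

text \<open>Inserting a first argument is an antiderivation of the wedge product; identities of forms are
  therefore proved by induction on the list of arguments.\<close>

lemma wedge_Cons:
  "(\<phi> \<and>\<^sub>q \<psi>) (v # vs) =
     ((\<lambda>ws. \<phi> (v # ws)) \<and>\<^sub>q \<psi>) vs + ((\<lambda>ws. (- 1) ^ length ws * \<phi> ws) \<and>\<^sub>q (\<lambda>ws. \<psi> (v # ws))) vs"
proof -
  let ?n = "length vs"
  let ?t = "\<lambda>I. shuffle_sign (Suc ?n) I * (\<phi> (nths (v # vs) I) * \<psi> (nths (v # vs) (- I)))"
  \<comment> \<open>The sets of positions are split by whether they contain 0, that is, by which
    factor receives the first argument \<open>v\<close>.\<close>
  have split: "Pow {..<Suc ?n} = insert 0 ` (image Suc ` Pow {..<?n}) \<union> image Suc ` Pow {..<?n}"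
    by (simp add: lessThan_Suc_eq_insert_0 Pow_insert image_Pow_surj[OF refl] Un_commute)
  have shift: "{j. Suc j \<in> insert 0 (Suc ` I)} = I" "{j. Suc j \<in> Suc ` I} = I"
    "{j. Suc j \<in> - insert 0 (Suc ` I)} = - I" "{j. Suc j \<in> - (Suc ` I)} = - I"
    "{j. Suc j \<notin> Suc ` I} = - I" for I
    by auto
  have "(\<phi> \<and>\<^sub>q \<psi>) (v # vs) = sum ?t (Pow {..<Suc ?n})"
    by (simp add: wedge_def)
  also have "\<dots> = sum ?t (insert 0 ` (image Suc ` Pow {..<?n})) + sum ?t (image Suc ` Pow {..<?n})"
    unfolding split by (rule sum.union_disjoint) auto
  also have "sum ?t (image Suc ` Pow {..<?n}) = (\<Sum>I\<in>Pow {..<?n}. ?t (Suc ` I))"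
    by (subst sum.reindex) (auto simp: inj_on_def inj_image_eq_iff)
  also have "sum ?t (insert 0 ` (image Suc ` Pow {..<?n})) = (\<Sum>I\<in>Pow {..<?n}. ?t (insert 0 (Suc ` I)))"
    unfolding image_image
    by (subst sum.reindex) (auto simp: inj_on_def insert_eq_iff inj_image_eq_iff)
  also have "\<dots> = ((\<lambda>ws. \<phi> (v # ws)) \<and>\<^sub>q \<psi>) vs"
    unfolding wedge_def
    by (intro sum.cong refl) (simp add: nths_Cons shift shuffle_sign_Suc_in)
  also have "(\<Sum>I\<in>Pow {..<?n}. ?t (Suc ` I)) =
     ((\<lambda>ws. (- 1) ^ length ws * \<phi> ws) \<and>\<^sub>q (\<lambda>ws. \<psi> (v # ws))) vs"
    unfolding wedge_def
  proof (intro sum.cong refl)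
    fix I assume I: "I \<in> Pow {..<?n}"
    have "shuffle_sign (Suc ?n) (Suc ` I) = (- 1) ^ card (Suc ` I) * shuffle_sign ?n I"
      using I by (subst shuffle_sign_Suc_not_in) (auto simp: shift)
    moreover have "card (Suc ` I) = length (nths vs I)"
    proof -
      have "{i. i < ?n \<and> i \<in> I} = I" using I by auto
      then show ?thesis by (simp add: length_nths card_image)
    qed
    moreover have "((- 1) ^ k * s) * q = s * ((- 1) ^ k * q)" for k and s q :: quat
      by (cases "even k") simp_all
    ultimately show "?t (Suc ` I) = shuffle_sign ?n I *
       ((- 1) ^ length (nths vs I) * \<phi> (nths vs I) * \<psi> (v # nths vs (- I)))"
      by (simp add: nths_Cons shift mult.assoc)
  qed
  finally show ?thesis .
qed

text \<open>A type of its own makes the wedge product the multiplication of a \<open>ring_1\<close>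
  instance, so that identities of forms become ring identities. Its elements are arbitrary functions
  on lists, for which \<open>wedge_Cons\<close> holds as well.\<close>

typedef 'v qext = "UNIV :: ('v list \<Rightarrow> quat) set"
  morphisms ev Qext ..

declare Qext_inverse [OF UNIV_I, simp] and ev_inverse [simp]

lemma qext_eqI: "(\<And>vs. ev a vs = ev b vs) \<Longrightarrow> a = b"
  by (metis ev_inject ext)

definition contract :: "'v \<Rightarrow> 'v qext \<Rightarrow> 'v qext" where
  "contract v a = Qext (\<lambda>vs. ev a (v # vs))"

definition grading :: "'v qext \<Rightarrow> 'v qext" where
  "grading a = Qext (\<lambda>vs. (- 1) ^ length vs * ev a vs)"

instantiation qext :: (type) ring_1
begin

definition zero_qext :: "'a qext" where "0 = Qext (\<lambda>vs. 0)"
definition one_qext :: "'a qext" where "1 = Qext (\<lambda>vs. if vs = [] then 1 else 0)"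
definition plus_qext :: "'a qext \<Rightarrow> 'a qext \<Rightarrow> 'a qext" where "a + b = Qext (\<lambda>vs. ev a vs + ev b vs)"
definition minus_qext :: "'a qext \<Rightarrow> 'a qext \<Rightarrow> 'a qext" where "a - b = Qext (\<lambda>vs. ev a vs - ev b vs)"
definition uminus_qext :: "'a qext \<Rightarrow> 'a qext" where "- a = Qext (\<lambda>vs. - ev a vs)"
definition times_qext :: "'a qext \<Rightarrow> 'a qext \<Rightarrow> 'a qext" where "a * b = Qext (ev a \<and>\<^sub>q ev b)"

lemma ev_ring [simp]:
  "ev 0 vs = 0" "ev (a + b) vs = ev a vs + ev b vs" "ev (a - b) vs = ev a vs - ev b vs"
  "ev (- a) vs = - ev a vs"
  by (simp_all add: zero_qext_def plus_qext_def minus_qext_def uminus_qext_def)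

lemma ev_mult_Nil [simp]: "ev (a * b) [] = ev a [] * ev b []"
  by (simp add: times_qext_def)

lemma ev_mult_Cons:
  "ev (a * b) (v # vs) = ev (contract v a * b) vs + ev (grading a * contract v b) vs"
  by (simp add: times_qext_def wedge_Cons contract_def grading_def)

lemma grading_mult: "grading (a * b) = grading a * grading b"
proof (rule qext_eqI)
  fix vs
  have "(- 1) ^ length vs * (ev a \<and>\<^sub>q ev b) vs =
      ((\<lambda>vs. (- 1) ^ length vs * ev a vs) \<and>\<^sub>q (\<lambda>vs. (- 1) ^ length vs * ev b vs)) vs"
    unfolding wedge_def sum_distrib_left
  proof (intro sum.cong refl)
    fix I assume "I \<in> Pow {..<length vs}"
    have "{i. i < length vs \<and> i \<in> I} \<union> {i. i < length vs \<and> i \<in> - I} = {..<length vs}"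
      by auto
    then have "length vs = card ({i. i < length vs \<and> i \<in> I} \<union> {i. i < length vs \<and> i \<in> - I})"
      by simp
    also have "\<dots> = length (nths vs I) + length (nths vs (- I))"
      unfolding length_nths by (rule card_Un_disjoint) auto
    finally have len: "length vs = length (nths vs I) + length (nths vs (- I))" .
    have "(- 1) ^ (m + k) * (s * (p * q)) = s * ((- 1) ^ m * p * ((- 1) ^ k * q))"
      for m k and s p q :: quat
      by (cases "even m"; cases "even k") simp_all
    then show "(- 1) ^ length vs * (shuffle_sign (length vs) I * (ev a (nths vs I) * ev b (nths vs (- I)))) =
       shuffle_sign (length vs) I * ((- 1) ^ length (nths vs I) * ev a (nths vs I) *
         ((- 1) ^ length (nths vs (- I)) * ev b (nths vs (- I))))"
      by (metis len)
  qed
  then show "ev (grading (a * b)) vs = ev (grading a * grading b) vs"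
    by (simp add: times_qext_def grading_def)
qed

lemma wedge_linear:
  "ev ((a + b) * c) vs = ev (a * c) vs + ev (b * c) vs"
  "ev (a * (b + c)) vs = ev (a * b) vs + ev (a * c) vs"
  "ev (0 * a) vs = 0" "ev (a * 0) vs = 0"
  by (simp_all add: times_qext_def wedge_def algebra_simps sum.distrib)

lemma contract_mult: "contract v (a * b) = contract v a * b + grading a * contract v b"
  by (rule qext_eqI) (simp add: contract_def ev_mult_Cons)

text \<open>Both sides obey the same antiderivation rule, and on the empty list this is
  associativity of the quaternions. The induction keeps \<open>a\<close>, \<open>b\<close>,
  \<open>c\<close> arbitrary because contraction and grading change the factors. Values are
  compared, since the ring laws become available only with the instance.\<close>

lemma qext_mult_assoc: "ev ((a * b) * c) vs = ev (a * (b * c)) vs"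
proof (induction vs arbitrary: a b c)
  case Nil
  show ?case by (simp add: mult.assoc)
next
  case (Cons v vs)
  show ?case
    unfolding ev_mult_Cons contract_mult wedge_linear grading_mult Cons.IH by (simp add: add.assoc)
qed

lemma contract_one: "contract v 1 = 0"
  by (rule qext_eqI) (simp add: contract_def one_qext_def)

lemma grading_one: "grading 1 = 1"
  by (rule qext_eqI) (simp add: grading_def one_qext_def)

lemma qext_one_mult: "ev (1 * a) vs = ev a vs"
  by (induction vs arbitrary: a)
    (simp_all add: ev_mult_Cons contract_one grading_one wedge_linear, simp_all add: one_qext_def contract_def)

lemma qext_mult_one: "ev (a * 1) vs = ev a vs"
  by (induction vs arbitrary: a)
    (simp_all add: ev_mult_Cons contract_one wedge_linear, simp_all add: one_qext_def contract_def)

instance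
proof
  have "ev (0::'a qext) [] \<noteq> ev 1 []"
    by (simp add: one_qext_def)
  then show "(0::'a qext) \<noteq> 1"
    by metis
next
  fix a b c :: "'a qext"
  show "a * b * c = a * (b * c)" "1 * a = a" "a * 1 = a"
    "(a + b) * c = a * c + b * c" "a * (b + c) = a * b + a * c"
    by (rule qext_eqI, simp add: qext_mult_assoc wedge_linear qext_one_mult qext_mult_one)+
  show "a + b + c = a + (b + c)" "a + b = b + a" "0 + a = a" "- a + a = 0" "a - b = a + - b"
    by (rule qext_eqI, simp add: algebra_simps)+
qed

end

section \<open>Constants and real covectors\<close>

definition const :: "quat \<Rightarrow> 'v qext" where "const q = Qext (\<lambda>vs. if vs = [] then q else 0)"

text \<open>Real-valued 1-forms serve as generators because they commute with quaternion constants: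
  all coefficients can be collected to the left of a product of covectors.\<close>

definition covec :: "('v \<Rightarrow> real) \<Rightarrow> 'v qext" where "covec a = Qext (one_form (\<lambda>v. of_real (a v)))"

lemma qext_eq_contractI: "ev a [] = ev b [] \<Longrightarrow> (\<And>v. contract v a = contract v b) \<Longrightarrow> a = b"
  by (rule qext_eqI) (metis contract_def Qext_inverse UNIV_I list.exhaust)

lemma contract_simps [simp]:
  "contract v (a + b) = contract v a + contract v b"
  "contract v (a - b) = contract v a - contract v b"
  "contract v (- a) = - contract v a" "contract v 0 = 0"
  "contract v (const q) = 0" "contract v (covec f) = const (of_real (f v))"
  by (rule qext_eqI; simp add: contract_def const_def covec_def one_form_def split: list.split)+

lemma grading_simps [simp]:
  "grading (a + b) = grading a + grading b" "grading (a - b) = grading a - grading b"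
  "grading (- a) = - grading a" "grading 0 = 0"
  "grading (const q) = const q" "grading (covec f) = - covec f"
  by (rule qext_eqI; simp add: grading_def const_def covec_def one_form_def algebra_simps split: list.split)+

lemma ev_Nil [simp]: "ev (const q) [] = q" "ev (covec f) [] = 0"
  by (simp_all add: const_def covec_def one_form_def)

lemma ev_const_mult [simp]: "ev (const q * a) vs = q * ev a vs"
  by (induction vs arbitrary: a)
    (simp_all add: ev_mult_Cons, simp_all add: contract_def)

lemma ev_mult_const [simp]: "ev (a * const q) vs = ev a vs * q"
  by (induction vs arbitrary: a)
    (simp_all add: ev_mult_Cons, simp_all add: contract_def)

lemma const_simps:
  "const (p + q) = const p + const q" "const (p - q) = const p - const q" "const (- p) = - const p"
  "const (p * q) = const p * const q" "const 0 = 0"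
  by (rule qext_eqI; simp; simp add: const_def)+

lemma const_1: "const 1 = 1"
  by (simp add: const_def one_qext_def)

lemma covec_const: "covec f * const q = const q * covec f"
  by (rule qext_eqI) (simp add: covec_def one_form_def of_real_def split: list.split)

lemma const_of_real_commute: "const (of_real r) * a = a * const (of_real r)"
  by (rule qext_eqI) (simp add: of_real_def)

lemma covec_anticommute: "covec f * covec g = - (covec g * covec f)"
  by (rule qext_eq_contractI) (simp_all add: contract_mult covec_const)

text \<open>Anticommutativity would only show that twice the square is 0. Contraction leaves a real
  multiple of the covector minus the same multiple, so all contractions vanish.\<close>

lemma covec_square: "covec f * covec f = 0"
  by (rule qext_eq_contractI) (simp_all add: contract_mult const_of_real_commute)

lemma Qext_wedge: "Qext (\<phi> \<and>\<^sub>q \<psi>) = Qext \<phi> * Qext \<psi>"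
  by (simp add: times_qext_def)

lemma sum_lessThan_4: "(\<Sum>k<4::nat. h k) = h 0 + h 1 + h 2 + (h 3 :: 'a::comm_monoid_add)"
  by (simp add: eval_nat_numeral)

lemma iunit_simps:
  "iunit 0 = 1" "iunit 1 * iunit 1 = - 1" "iunit 2 * iunit 2 = - 1" "iunit 3 * iunit 3 = - 1"
  "iunit 1 * iunit 2 = iunit 3" "iunit 2 * iunit 3 = iunit 1" "iunit 3 * iunit 1 = iunit 2"
  "iunit 2 * iunit 1 = - iunit 3" "iunit 3 * iunit 2 = - iunit 1" "iunit 1 * iunit 3 = - iunit 2"
  "qcnj (iunit 1) = - iunit 1" "qcnj (iunit 2) = - iunit 2" "qcnj (iunit 3) = - iunit 3" "qcnj 1 = 1"
  by (simp_all add: iunit_def qcnj_def quat_eq_iff times_quat_def uminus_quat_def one_quat_def eval_nat_numeral)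

section \<open>Identities in one quaternionic coordinate\<close>

context
  fixes g :: "nat \<Rightarrow> 'v \<Rightarrow> real"
begin

text \<open>The four functions \<open>g\<close> are left arbitrary, so that the x-coordinates and
  the y-coordinates are instances of the same identities.\<close>

definition vol4 :: "'v qext" where "vol4 = covec (g 0) * covec (g 1) * covec (g 2) * covec (g 3)"

definition qdiff :: "'v qext" where "qdiff = (\<Sum>\<alpha><4. const (iunit \<alpha>) * covec (g \<alpha>))"

definition cqdiff :: "'v qext" where "cqdiff = (\<Sum>\<alpha><4. const (qcnj (iunit \<alpha>)) * covec (g \<alpha>))"

text \<open>The signs are those of the contraction of the volume form with the \<open>k\<close>-th coordinate vector.\<close>

definition face :: "nat \<Rightarrow> 'v qext" where
  "face k = [covec (g 1) * covec (g 2) * covec (g 3), - (covec (g 0) * covec (g 2) * covec (g 3)),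
     covec (g 0) * covec (g 1) * covec (g 3), - (covec (g 0) * covec (g 1) * covec (g 2))] ! k"

lemma face_simps:
  "face 0 = covec (g 1) * covec (g 2) * covec (g 3)"
  "face 1 = - (covec (g 0) * covec (g 2) * covec (g 3))"
  "face 2 = covec (g 0) * covec (g 1) * covec (g 3)"
  "face 3 = - (covec (g 0) * covec (g 1) * covec (g 2))"
  by (simp_all add: face_def eval_nat_numeral)

lemma const_left: "covec f * (const q * z) = const q * (covec f * z)"
  by (metis covec_const mult.assoc)

lemma anticommute_left: "covec f * (covec h * z) = - (covec h * (covec f * z))"
  by (metis covec_anticommute minus_mult_left mult.assoc)

lemma square_left: "covec f * (covec f * z) = 0"
  by (metis covec_square mult_zero_left mult.assoc)

text \<open>Only the instances with the larger index on the left: as rewrite rules they sort a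
  product of coordinate covectors, whereas the general law could be applied back and forth.\<close>

lemmas coord_swap =
  covec_anticommute[of "g 1" "g 0"] anticommute_left[of "g 1" "g 0"]
  covec_anticommute[of "g 2" "g 0"] anticommute_left[of "g 2" "g 0"]
  covec_anticommute[of "g 3" "g 0"] anticommute_left[of "g 3" "g 0"]
  covec_anticommute[of "g 2" "g 1"] anticommute_left[of "g 2" "g 1"]
  covec_anticommute[of "g 3" "g 1"] anticommute_left[of "g 3" "g 1"]
  covec_anticommute[of "g 3" "g 2"] anticommute_left[of "g 3" "g 2"]
  covec_square square_left

text \<open>The multiplication table with a trailing factor \<open>z\<close>, the shape in which two
  units meet once products are nested to the right.\<close>

lemma const_iunit_mult:
  "const (iunit 1) * (const (iunit 1) * z) = - z" "const (iunit 2) * (const (iunit 2) * z) = - z"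
  "const (iunit 3) * (const (iunit 3) * z) = - z"
  "const (iunit 1) * (const (iunit 2) * z) = const (iunit 3) * z"
  "const (iunit 2) * (const (iunit 3) * z) = const (iunit 1) * z"
  "const (iunit 3) * (const (iunit 1) * z) = const (iunit 2) * z"
  "const (iunit 2) * (const (iunit 1) * z) = - (const (iunit 3) * z)"
  "const (iunit 3) * (const (iunit 2) * z) = - (const (iunit 1) * z)"
  "const (iunit 1) * (const (iunit 3) * z) = - (const (iunit 2) * z)"
  by (simp_all flip: mult.assoc const_simps(4) add: iunit_simps del: One_nat_def)
    (simp_all add: iunit_simps const_simps const_1 del: One_nat_def)

text \<open>For \<alpha> \<noteq> \<beta> the product of the conjugate of
  \<open>iunit \<alpha>\<close> with \<open>iunit \<beta>\<close> is imaginary, so exchanging the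
  indices changes its sign and \<open>cqdiff * qdiff\<close> is twice a sum over \<alpha> < \<beta>.
  By anti-self-duality \<open>face \<delta>\<close> receives
  \<open>- 2 * (qcnj (iunit \<delta>) * iunit \<gamma> * L \<gamma>)\<close> from each \<gamma>
  \<noteq> \<delta>. Completing the sum by \<gamma> = \<delta> adds \<open>L \<delta>\<close> inside
  the bracket, which is subtracted again.\<close>

lemma cqdiff_qdiff:
  "cqdiff * qdiff * (\<Sum>\<gamma><4. const (L \<gamma>) * covec (g \<gamma>)) =
     - 2 * (\<Sum>\<delta><4. const (qcnj (iunit \<delta>) * (\<Sum>\<gamma><4. iunit \<gamma> * L \<gamma>) - L \<delta>) * face \<delta>)"
proof -
  have two: "- 2 * z = - z - z" for z :: "'v qext"
    by (metis diff_conv_add_uminus mult_2 mult_minus_left minus_add_distrib)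
  show ?thesis
    unfolding two qdiff_def cqdiff_def sum_lessThan_4 face_simps
    by (simp only: iunit_simps const_simps const_1 mult.assoc distrib_left distrib_right
        left_diff_distrib right_diff_distrib covec_const const_left
        coord_swap const_iunit_mult mult_minus_left mult_minus_right minus_minus mult_1_left mult_1_right
        minus_add_distrib mult_zero_right minus_diff_eq)
      (simp add: algebra_simps)
qed

text \<open>\<open>face \<alpha>\<close> annihilates every coordinate covector except the one it
  omits. Multiplied by that one on the left it gives \<open>vol4\<close>; on the right the covector
  has passed three others, hence the minus sign.\<close>

lemma dirac_dual:
  "(\<Sum>\<alpha><4. const (iunit \<alpha>) * face \<alpha>) * (\<Sum>\<gamma><4. const (L \<gamma>) * covec (g \<gamma>)) =
     - (const (\<Sum>\<gamma><4. iunit \<gamma> * L \<gamma>) * vol4)"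
  unfolding vol4_def sum_lessThan_4 face_simps
  by (simp add: iunit_simps const_simps const_1 algebra_simps covec_const const_left coord_swap del: One_nat_def)

lemma contract_vol4: "contract v vol4 = (\<Sum>k<4. const (of_real (g k v)) * face k)"
  unfolding vol4_def sum_lessThan_4 face_simps
  by (simp add: contract_mult algebra_simps covec_const const_left)

lemma vol4_covec: "vol4 * covec f = covec f * vol4"
  unfolding vol4_def
  by (simp add: mult.assoc anticommute_left[of _ f] covec_anticommute[of _ f])

lemma vol4_const: "vol4 * const q = const q * vol4"
  unfolding vol4_def by (simp add: mult.assoc covec_const const_left)

lemma covec_vol4: "k < 4 \<Longrightarrow> covec (g k) * vol4 = 0"
proof -
  assume "k < 4"
  then consider "k = 0" | "k = 1" | "k = 2" | "k = 3" by linarith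
  then show ?thesis
    by cases (simp_all add: vol4_def mult.assoc coord_swap del: One_nat_def)
qed

lemma grading_vol4: "grading vol4 = vol4"
  by (simp add: vol4_def grading_mult)

end


section \<open>Coordinates on pairs of quaternions\<close>

lemma iunit_inner: "\<alpha> < 4 \<Longrightarrow> \<beta> < 4 \<Longrightarrow> iunit \<alpha> \<bullet> iunit \<beta> = (if \<alpha> = \<beta> then 1 else 0)"
  by (auto simp: inner_quat_def iunit_def eval_nat_numeral less_Suc_eq)

lemma ddx_inner [simp]:
  "\<alpha> < 4 \<Longrightarrow> \<beta> < 4 \<Longrightarrow> ddx \<alpha> \<bullet> ddx \<beta> = (if \<alpha> = \<beta> then 1 else 0)"
  "\<alpha> < 4 \<Longrightarrow> \<beta> < 4 \<Longrightarrow> ddy \<alpha> \<bullet> ddy \<beta> = (if \<alpha> = \<beta> then 1 else 0)"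
  "ddx \<alpha> \<bullet> ddy \<beta> = 0" "ddy \<alpha> \<bullet> ddx \<beta> = 0"
  by (simp_all add: ddx_def ddy_def inner_prod_def iunit_inner)

lemma iunit_Quat:
  "iunit 0 = Quat 1 0 0 0" "iunit 1 = Quat 0 1 0 0" "iunit 2 = Quat 0 0 1 0" "iunit 3 = Quat 0 0 0 1"
  by (simp_all add: iunit_def eval_nat_numeral)

lemma quat_expansion: "(\<Sum>\<alpha><4. (iunit \<alpha> \<bullet> q) *\<^sub>R iunit \<alpha>) = q"
  by (cases q) (simp del: One_nat_def add: sum_lessThan_4 iunit_Quat inner_quat_def scaleR_quat_def plus_quat_def quat_eq_iff)

lemma quat_cnj_expansion: "(\<Sum>\<alpha><4. (iunit \<alpha> \<bullet> q) *\<^sub>R qcnj (iunit \<alpha>)) = qcnj q"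
  by (cases q) (simp del: One_nat_def add: sum_lessThan_4 iunit_Quat inner_quat_def scaleR_quat_def plus_quat_def quat_eq_iff qcnj_def)

lemma qpoint_expansion: "(\<Sum>\<alpha><4. (ddx \<alpha> \<bullet> z) *\<^sub>R ddx \<alpha>) + (\<Sum>\<alpha><4. (ddy \<alpha> \<bullet> z) *\<^sub>R ddy \<alpha>) = z"
proof -
  have "(\<Sum>\<alpha><4. (ddx \<alpha> \<bullet> z) *\<^sub>R ddx \<alpha>) = (\<Sum>\<alpha><4. (iunit \<alpha> \<bullet> fst z) *\<^sub>R iunit \<alpha>, 0)"
    "(\<Sum>\<alpha><4. (ddy \<alpha> \<bullet> z) *\<^sub>R ddy \<alpha>) = (0, \<Sum>\<alpha><4. (iunit \<alpha> \<bullet> snd z) *\<^sub>R iunit \<alpha>)"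
    by (simp_all add: prod_eq_iff fst_sum snd_sum ddx_def ddy_def inner_prod_def)
  then show ?thesis by (simp add: quat_expansion)
qed

abbreviation "gx \<equiv> (\<lambda>\<alpha> v. v \<bullet> ddx \<alpha>)"
abbreviation "gy \<equiv> (\<lambda>\<alpha> v. v \<bullet> ddy \<alpha>)"

lemma Qext_const_sum: "Qext (\<lambda>vs. \<Sum>\<alpha><(4::nat). q \<alpha> * h \<alpha> vs) = (\<Sum>\<alpha><4. const (q \<alpha>) * Qext (h \<alpha>))"
  by (rule qext_eqI) (simp add: sum_lessThan_4)

lemma Qext_forms:
  "Qext (dx \<alpha>) = covec (gx \<alpha>)" "Qext (dy \<alpha>) = covec (gy \<alpha>)"
  "Qext dx_vol = vol4 gx" "Qext dy_vol = vol4 gy"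
  "Qext dq1 = qdiff gx" "Qext dq2 = qdiff gy" "Qext cdq1 = cqdiff gx" "Qext cdq2 = cqdiff gy"
  "Qext Dq1 = (\<Sum>\<alpha><4. const (iunit \<alpha>) * face gx \<alpha>)"
  "Qext Dq2 = (\<Sum>\<alpha><4. const (iunit \<alpha>) * face gy \<alpha>)"
proof -
  show dxy: "Qext (dx \<alpha>) = covec (gx \<alpha>)" "Qext (dy \<alpha>) = covec (gy \<alpha>)" for \<alpha>
    by (simp_all add: dx_def dy_def covec_def)
  show "Qext dx_vol = vol4 gx" "Qext dy_vol = vol4 gy"
    by (simp_all only: dx_vol_def dy_vol_def Qext_wedge dxy vol4_def)
  show "Qext dq1 = qdiff gx" "Qext dq2 = qdiff gy" "Qext cdq1 = cqdiff gx" "Qext cdq2 = cqdiff gy"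
    unfolding dq1_def[abs_def] dq2_def[abs_def] cdq1_def[abs_def] cdq2_def[abs_def] Qext_const_sum
      dxy qdiff_def cqdiff_def by simp_all
  show "Qext Dq1 = (\<Sum>\<alpha><4. const (iunit \<alpha>) * face gx \<alpha>)"
    by (rule qext_eqI)
      (simp add: Dq1_def sum_lessThan_4 face_simps flip: dxy Qext_wedge del: One_nat_def)
  show "Qext Dq2 = (\<Sum>\<alpha><4. const (iunit \<alpha>) * face gy \<alpha>)"
    by (rule qext_eqI)
      (simp add: Dq2_def sum_lessThan_4 face_simps flip: dxy Qext_wedge del: One_nat_def)
qed

lemma linear_one_form:
  assumes "linear L"
  shows "Qext (one_form L) = (\<Sum>\<gamma><4. const (L (ddx \<gamma>)) * covec (gx \<gamma>)) + (\<Sum>\<gamma><4. const (L (ddy \<gamma>)) * covec (gy \<gamma>))"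
proof -
  have L: "L v = (\<Sum>\<alpha><4. (ddx \<alpha> \<bullet> v) *\<^sub>R L (ddx \<alpha>)) + (\<Sum>\<alpha><4. (ddy \<alpha> \<bullet> v) *\<^sub>R L (ddy \<alpha>))" for v
    using arg_cong[OF qpoint_expansion[of v], of L]
    by (simp add: linear_add[OF assms] linear_sum[OF assms] linear_scale[OF assms])
  have "one_form L vs = ev ((\<Sum>\<gamma><4. const (L (ddx \<gamma>)) * covec (gx \<gamma>)) + (\<Sum>\<gamma><4. const (L (ddy \<gamma>)) * covec (gy \<gamma>))) vs" for vs
  proof (cases "\<exists>v. vs = [v]")
    case True
    then obtain v where vs: "vs = [v]" by blast
    have "L v = ev ((\<Sum>\<gamma><4. const (L (ddx \<gamma>)) * covec (gx \<gamma>)) + (\<Sum>\<gamma><4. const (L (ddy \<gamma>)) * covec (gy \<gamma>))) [v]"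
      unfolding L[of v]
      by (simp add: sum_lessThan_4 covec_def one_form_def inner_commute of_real_def)
    then show ?thesis by (simp add: vs one_form_def)
  next
    case False
    then show ?thesis by (auto simp: sum_lessThan_4 covec_def one_form_def split: list.split)
  qed
  then show ?thesis by (intro qext_eqI) simp
qed

text \<open>The 1-form is split into its x-part and its y-part. \<open>dy_vol\<close> annihilates
  the y-part and \<open>dx_vol\<close> the x-part; both have even degree and can be moved past
  covectors. \<open>cqdiff_qdiff\<close> evaluates the two remaining products, and its factor -2
  cancels the -1/2 in the definition of \<open>f_perp\<close>.\<close>

lemma volume_decomposition:
  assumes "linear L"
  defines "D1 \<equiv> \<Sum>\<alpha><4. iunit \<alpha> * L (ddx \<alpha>)" and "D2 \<equiv> \<Sum>\<alpha><4. iunit \<alpha> * L (ddy \<alpha>)"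
  shows "Qext ((\<lambda>vs. (- 1 / 2) *\<^sub>R ((cdq1 \<and>\<^sub>q dq1 \<and>\<^sub>q dy_vol) vs + (dx_vol \<and>\<^sub>q cdq2 \<and>\<^sub>q dq2) vs)) \<and>\<^sub>q one_form L) =
    (\<Sum>\<delta><4. const (qcnj (iunit \<delta>) * D1 - L (ddx \<delta>)) * (face gx \<delta> * vol4 gy)) +
    (\<Sum>\<delta><4. const (qcnj (iunit \<delta>) * D2 - L (ddy \<delta>)) * (vol4 gx * face gy \<delta>))"
    (is "_ = ?S1 + ?S2")
proof -
  let ?h = "const ((- 1 / 2) *\<^sub>R 1) :: qpoint qext"
  let ?Lx = "\<Sum>\<gamma><4. const (L (ddx \<gamma>)) * covec (gx \<gamma>)" and ?Ly = "\<Sum>\<gamma><4. const (L (ddy \<gamma>)) * covec (gy \<gamma>)"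
  have half: "Qext (\<lambda>vs. (- 1 / 2) *\<^sub>R (\<phi> vs + \<psi> vs)) = ?h * (Qext \<phi> + Qext \<psi>)" for \<phi> \<psi> :: "qpoint qform"
    by (rule qext_eqI) simp
  have h2: "?h * (- 2 * z) = z" for z
  proof (rule qext_eqI)
    fix vs
    have "- ev z vs - ev z vs = - (2 *\<^sub>R ev z vs)" by (simp add: scaleR_2)
    then show "ev (?h * (- 2 * z)) vs = ev z vs" by (simp add: mult_2)
  qed
  have y0: "vol4 gy * ?Ly = 0"
    unfolding sum_distrib_left
    by (intro sum.neutral ballI)
      (metis covec_vol4 lessThan_iff mult.assoc mult_zero_right vol4_const vol4_covec)
  have y1: "vol4 gy * ?Lx = ?Lx * vol4 gy"
    by (simp add: sum_distrib_left sum_distrib_right vol4_const flip: mult.assoc)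
       (simp add: mult.assoc vol4_covec)
  have vc: "vol4 gx * (const q * z) = const q * (vol4 gx * z)" for q z
    by (metis vol4_const mult.assoc)
  have v0: "vol4 gx * (covec f * (covec h * covec (gx \<gamma>))) = 0" if "\<gamma> < 4" for f h \<gamma>
  proof -
    have "vol4 gx * (covec f * (covec h * covec (gx \<gamma>))) = vol4 gx * covec (gx \<gamma>) * covec f * covec h"
      by (simp add: mult.assoc anticommute_left[of f "gx \<gamma>"] covec_anticommute[of h "gx \<gamma>"])
    also have "vol4 gx * covec (gx \<gamma>) = 0"
      by (metis vol4_covec covec_vol4 that)
    finally show ?thesis by simp
  qed
  have x0: "vol4 gx * (cqdiff gy * qdiff gy * ?Lx) = 0"
    unfolding cqdiff_def qdiff_def
    by (simp add: sum_distrib_left sum_distrib_right mult.assoc const_left vc v0 covec_const)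
  have "?h * ((cqdiff gx * qdiff gx * vol4 gy) + (vol4 gx * cqdiff gy * qdiff gy)) * (?Lx + ?Ly) =
     ?h * (cqdiff gx * qdiff gx * ?Lx) * vol4 gy + vol4 gx * (?h * (cqdiff gy * qdiff gy * ?Ly))"
    using x0 by (simp add: distrib_left distrib_right mult.assoc y0 y1 vc)
  also have "\<dots> = ?S1 + ?S2"
    unfolding cqdiff_qdiff h2 D1_def[symmetric] D2_def[symmetric]
    by (simp add: sum_distrib_left sum_distrib_right vc mult.assoc)
  finally show ?thesis
    by (simp only: Qext_wedge half linear_one_form[OF assms(1)] Qext_forms)
qed

section \<open>The normal component\<close>

lemma ev_covec_mult_zero:
  assumes "\<forall>v\<in>set vs. f v = 0"
  shows "ev (covec f * z) vs = 0"
  using assms by (induction vs arbitrary: z) (simp_all add: ev_mult_Cons)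

definition vol :: "qpoint qext" where "vol = vol4 gx * vol4 gy"

lemma contract_vol_ddx: "\<alpha> < 4 \<Longrightarrow> contract (ddx \<alpha>) vol = face gx \<alpha> * vol4 gy"
proof -
  assume "\<alpha> < 4"
  then consider "\<alpha> = 0" | "\<alpha> = 1" | "\<alpha> = 2" | "\<alpha> = 3" by linarith
  then show ?thesis
    by cases (simp_all add: vol_def contract_mult contract_vol4 sum_lessThan_4 const_simps const_1 del: One_nat_def)
qed

lemma contract_vol_ddy: "\<alpha> < 4 \<Longrightarrow> contract (ddy \<alpha>) vol = vol4 gx * face gy \<alpha>"
proof -
  assume "\<alpha> < 4"
  then consider "\<alpha> = 0" | "\<alpha> = 1" | "\<alpha> = 2" | "\<alpha> = 3" by linarith
  then show ?thesis
    by cases (simp_all add: vol_def contract_mult contract_vol4 grading_vol4 sum_lessThan_4 const_simps const_1 del: One_nat_def)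
qed

text \<open>The covector is a combination of the eight coordinate covectors, each of which already
  occurs in \<open>vol\<close>.\<close>

lemma covec_inner_vol: "covec (\<lambda>v. v \<bullet> n) * vol = 0"
proof -
  have n: "v \<bullet> n = (\<Sum>\<alpha><4. (ddx \<alpha> \<bullet> n) * (v \<bullet> ddx \<alpha>)) + (\<Sum>\<alpha><4. (ddy \<alpha> \<bullet> n) * (v \<bullet> ddy \<alpha>))" for v
    using arg_cong[OF qpoint_expansion[of n], of "inner v"] by (simp add: inner_right_distrib inner_sum_right)
  have "covec (\<lambda>v. v \<bullet> n) = (\<Sum>\<alpha><4. const (of_real (ddx \<alpha> \<bullet> n)) * covec (gx \<alpha>)) +
      (\<Sum>\<alpha><4. const (of_real (ddy \<alpha> \<bullet> n)) * covec (gy \<alpha>))" (is "_ = ?R")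
  proof (rule qext_eqI)
    fix vs
    show "ev (covec (\<lambda>v. v \<bullet> n)) vs = ev ?R vs"
    proof (cases "\<exists>v. vs = [v]")
      case True
      then obtain v where vs: "vs = [v]" by blast
      have "ev ?R [v] = of_real ((\<Sum>\<alpha><4. (ddx \<alpha> \<bullet> n) * (v \<bullet> ddx \<alpha>)) + (\<Sum>\<alpha><4. (ddy \<alpha> \<bullet> n) * (v \<bullet> ddy \<alpha>)))"
        by (simp add: covec_def one_form_def sum_lessThan_4)
      also have "\<dots> = ev (covec (\<lambda>v. v \<bullet> n)) [v]"
        unfolding n[of v, symmetric] by (simp add: covec_def one_form_def)
      finally show ?thesis by (simp add: vs)
    qed (auto simp: covec_def one_form_def sum_lessThan_4 split: list.split)
  qed
  moreover have "covec (gx \<alpha>) * vol = 0" "covec (gy \<alpha>) * vol = 0" if "\<alpha> < 4" for \<alpha>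
  proof -
    show "covec (gx \<alpha>) * vol = 0"
      unfolding vol_def mult.assoc[symmetric] covec_vol4[OF that, of gx] by simp
    have "covec (gy \<alpha>) * vol = vol4 gx * (covec (gy \<alpha>) * vol4 gy)"
      unfolding vol_def mult.assoc[symmetric] vol4_covec[of gx] by simp
    then show "covec (gy \<alpha>) * vol = 0"
      using covec_vol4[OF that, of gy] by simp
  qed
  ultimately show ?thesis
    by (simp add: distrib_right sum_distrib_right mult.assoc)
qed

text \<open>Contract \<open>n\<^sup>\<flat> \<and> vol = 0\<close> first with \<open>e\<close> and then with \<open>n\<close>; on the orthogonal complement of
  \<open>n\<close> the terms with a factor \<open>n\<^sup>\<flat>\<close> vanish.\<close>

lemma contract_vol_restrict:
  assumes "n \<bullet> n = 1" and "vs \<in> lists {v. v \<bullet> n = 0}"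
  shows "ev (contract e vol) vs = (e \<bullet> n) *\<^sub>R ev (contract n vol) vs"
proof -
  let ?N = "covec (\<lambda>v. v \<bullet> n) :: qpoint qext"
  have "contract e (?N * vol) = 0" by (simp add: covec_inner_vol)
  then have "const (of_real (e \<bullet> n)) * vol = ?N * contract e vol" by (simp add: contract_mult)
  then have "contract n (const (of_real (e \<bullet> n)) * vol) = contract n (?N * contract e vol)" by simp
  then have "const (of_real (e \<bullet> n)) * contract n vol = contract e vol - ?N * contract n (contract e vol)"
    by (simp add: contract_mult assms const_1)
  then have "ev (const (of_real (e \<bullet> n)) * contract n vol) vs = ev (contract e vol - ?N * contract n (contract e vol)) vs"
    by simp
  then show ?thesis using assms(2)
    by (subst (asm) ev_ring, subst (asm) ev_covec_mult_zero) (auto simp: of_real_def)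
qed

lemma ev_mult_Cons_contract0:
  "contract v z = 0 \<Longrightarrow> ev (covec a * z) (v # vs) = a v *\<^sub>R ev z vs"
  by (simp add: ev_mult_Cons of_real_def)

text \<open>The vectors \<open>ddx \<alpha>\<close> are pushed into the orthogonal complement of
  \<open>n\<close> along \<open>u = (0, snd n)\<close>. The x-coordinates do not see this shift, so
  \<open>vol4 gx\<close> still takes the value 1.\<close>

lemma dx_vol_nonzero:
  assumes "snd n \<noteq> 0"
  shows "\<exists>vs\<in>lists {v. v \<bullet> n = 0}. ev (vol4 gx) vs = 1"
proof -
  define u :: qpoint where "u = (0, snd n)"
  define w where "w \<alpha> = ddx \<alpha> - ((ddx \<alpha> \<bullet> n) / (u \<bullet> n)) *\<^sub>R u" for \<alpha>
  have un: "u \<bullet> n \<noteq> 0" using assms by (simp add: u_def inner_prod_def)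
  have "w \<alpha> \<bullet> n = 0" for \<alpha> using un by (simp add: w_def inner_diff_left)
  moreover have "w \<alpha> \<bullet> ddx \<beta> = (if \<alpha> = \<beta> then 1 else 0)" if "\<alpha> < 4" "\<beta> < 4" for \<alpha> \<beta>
    using that by (simp add: w_def inner_diff_left u_def) (simp add: ddx_def)
  then have "ev (vol4 gx) [w 0, w 1, w 2, w 3] = 1"
    by (simp add: vol4_def mult.assoc ev_mult_Cons_contract0 contract_mult const_simps del: One_nat_def)
      (simp add: covec_def one_form_def)
  ultimately show ?thesis by (intro bexI[of _ "[w 0, w 1, w 2, w 3]"]) auto
qed

lemma dy_vol_nonzero:
  assumes "fst n \<noteq> 0"
  shows "\<exists>vs\<in>lists {v. v \<bullet> n = 0}. ev (vol4 gy) vs = 1"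
proof -
  define u :: qpoint where "u = (fst n, 0)"
  define w where "w \<alpha> = ddy \<alpha> - ((ddy \<alpha> \<bullet> n) / (u \<bullet> n)) *\<^sub>R u" for \<alpha>
  have un: "u \<bullet> n \<noteq> 0" using assms by (simp add: u_def inner_prod_def)
  have "w \<alpha> \<bullet> n = 0" for \<alpha> using un by (simp add: w_def inner_diff_left)
  moreover have "w \<alpha> \<bullet> ddy \<beta> = (if \<alpha> = \<beta> then 1 else 0)" if "\<alpha> < 4" "\<beta> < 4" for \<alpha> \<beta>
    using that by (simp add: w_def inner_diff_left u_def) (simp add: ddy_def)
  then have "ev (vol4 gy) [w 0, w 1, w 2, w 3] = 1"
    by (simp add: vol4_def mult.assoc ev_mult_Cons_contract0 contract_mult const_simps del: One_nat_def)
      (simp add: covec_def one_form_def)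
  ultimately show ?thesis by (intro bexI[of _ "[w 0, w 1, w 2, w 3]"]) auto
qed

text \<open>Makes the coefficient in the definition of \<open>f_perp\<close> unique. Some coordinate
  vector \<open>e\<close> has \<open>e \<bullet> n \<noteq> 0\<close>; the other seven are pushed
  along \<open>e\<close> into the orthogonal complement of \<open>n\<close>. The contraction with
  \<open>e\<close> does not see these shifts, and \<open>contract_vol_restrict\<close> passes from
  \<open>e\<close> to \<open>n\<close>. The value is real, hence central and cancellable.\<close>

lemma surface_vol_nonzero:
  assumes "n \<bullet> n = 1"
  shows "\<exists>vs\<in>lists {v. v \<bullet> n = 0}. \<exists>r. ev (contract n vol) vs = of_real r \<and> r \<noteq> 0"
proof -
  have "\<exists>e. e \<bullet> n \<noteq> 0 \<and> (\<exists>vs\<in>lists {v. v \<bullet> n = 0}. ev (contract e vol) vs \<in> {1, - 1})"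
  proof -
    have "\<exists>k<4. ddx k \<bullet> n \<noteq> 0 \<or> ddy k \<bullet> n \<noteq> 0"
    proof (rule ccontr)
      assume "\<not> ?thesis"
      then have "n = 0" using qpoint_expansion[of n] by simp
      then show False using assms by simp
    qed
    then obtain k where k: "k < 4" and "ddx k \<bullet> n \<noteq> 0 \<or> ddy k \<bullet> n \<noteq> 0" by blast
    let ?I = "filter (\<lambda>i. i \<noteq> k) [0, 1, 2, 3]"
    note [simp] = ev_mult_Cons_contract0 contract_mult const_simps face_simps const_1 inner_diff_left
    have k_cases: thesis if "k = 0 \<Longrightarrow> thesis" "k = 1 \<Longrightarrow> thesis" "k = 2 \<Longrightarrow> thesis" "k = 3 \<Longrightarrow> thesis" for thesis
      using that k by linarith
    from \<open>ddx k \<bullet> n \<noteq> 0 \<or> ddy k \<bullet> n \<noteq> 0\<close> show ?thesis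
    proof
      assume nk: "ddx k \<bullet> n \<noteq> 0"
      define w where "w v = v - ((v \<bullet> n) / (ddx k \<bullet> n)) *\<^sub>R ddx k" for v
      have T: "w v \<bullet> n = 0" for v using nk by (simp add: w_def)
      have dual: "w (ddx \<alpha>) \<bullet> ddx \<beta> = (if \<alpha> = \<beta> then 1 else 0)" "w (ddy \<alpha>) \<bullet> ddx \<beta> = 0"
        if "\<alpha> < 4" "\<beta> < 4" "\<beta> \<noteq> k" for \<alpha> \<beta> using that k by (simp_all add: w_def)
      have dual': "w (ddy \<alpha>) \<bullet> ddy \<beta> = (if \<alpha> = \<beta> then 1 else 0)" "w (ddx \<alpha>) \<bullet> ddy \<beta> = 0"
        if "\<alpha> < 4" "\<beta> < 4" for \<alpha> \<beta> using that k by (simp_all add: w_def)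
      let ?vs = "map w (map ddx ?I @ map ddy [0, 1, 2, 3])"
      \<comment> \<open>The sign depends on \<open>k\<close> through \<open>face\<close>; only
        nonvanishing matters.\<close>
      have "ev (contract (ddx k) vol) ?vs \<in> {1, - 1}"
        unfolding contract_vol_ddx[OF k] vol4_def
        by (rule k_cases) (simp_all add: dual dual' mult.assoc del: One_nat_def,
          simp_all add: covec_def one_form_def dual dual' del: One_nat_def)
      then show ?thesis using nk T by (intro exI[of _ "ddx k"] conjI bexI[of _ ?vs]) auto
    next
      assume nk: "ddy k \<bullet> n \<noteq> 0"
      define w where "w v = v - ((v \<bullet> n) / (ddy k \<bullet> n)) *\<^sub>R ddy k" for v
      have T: "w v \<bullet> n = 0" for v using nk by (simp add: w_def)
      have dual: "w (ddy \<alpha>) \<bullet> ddy \<beta> = (if \<alpha> = \<beta> then 1 else 0)" "w (ddx \<alpha>) \<bullet> ddy \<beta> = 0"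
        if "\<alpha> < 4" "\<beta> < 4" "\<beta> \<noteq> k" for \<alpha> \<beta> using that k by (simp_all add: w_def)
      have dual': "w (ddx \<alpha>) \<bullet> ddx \<beta> = (if \<alpha> = \<beta> then 1 else 0)" "w (ddy \<alpha>) \<bullet> ddx \<beta> = 0"
        if "\<alpha> < 4" "\<beta> < 4" for \<alpha> \<beta> using that k by (simp_all add: w_def)
      let ?vs = "map w (map ddx [0, 1, 2, 3] @ map ddy ?I)"
      have "ev (contract (ddy k) vol) ?vs \<in> {1, - 1}"
        unfolding contract_vol_ddy[OF k] vol4_def
        by (rule k_cases) (simp_all add: dual dual' mult.assoc del: One_nat_def,
          simp_all add: covec_def one_form_def dual dual' del: One_nat_def)
      then show ?thesis using nk T by (intro exI[of _ "ddy k"] conjI bexI[of _ ?vs]) auto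
    qed
  qed
  then obtain e vs where en: "e \<bullet> n \<noteq> 0" and vs: "vs \<in> lists {v. v \<bullet> n = 0}"
    and "ev (contract e vol) vs \<in> {1, - 1}" by blast
  then obtain s where "ev (contract e vol) vs = of_real s" "s \<noteq> 0"
    by (metis empty_iff insert_iff of_real_1 of_real_minus zero_neq_one neg_equal_0_iff_equal)
  moreover have "ev (contract n vol) vs = (1 / (e \<bullet> n)) *\<^sub>R ev (contract e vol) vs"
    unfolding contract_vol_restrict[OF assms vs, of e] using en by simp
  ultimately show ?thesis using vs en
    by (intro bexI[OF _ vs] exI[of _ "s / (e \<bullet> n)"]) (simp add: of_real_def)
qed

text \<open>Allows \<open>surface_diff\<close>, which is determined on tangent vectors only, to be
  replaced by a linear map inside a wedge product.\<close>

lemma wedge_cong_on: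
  assumes "\<And>vs. vs \<in> lists T \<Longrightarrow> \<phi> vs = \<phi>' vs" and "\<And>vs. vs \<in> lists T \<Longrightarrow> \<psi> vs = \<psi>' vs" and "vs \<in> lists T"
  shows "(\<phi> \<and>\<^sub>q \<psi>) vs = (\<phi>' \<and>\<^sub>q \<psi>') vs"
proof -
  have "nths vs I \<in> lists T" for I using assms(3) set_nths_subset[of vs I] by (auto simp: in_lists_conv_set)
  then show ?thesis by (simp add: wedge_def assms)
qed

lemma sum_iunit_inner:
  "(\<Sum>\<alpha><4. (ddx \<alpha> \<bullet> n) *\<^sub>R iunit \<alpha>) = fst n" "(\<Sum>\<alpha><4. (ddy \<alpha> \<bullet> n) *\<^sub>R iunit \<alpha>) = snd n"
  "(\<Sum>\<alpha><4. (ddx \<alpha> \<bullet> n) *\<^sub>R qcnj (iunit \<alpha>)) = qcnj (fst n)"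
  "(\<Sum>\<alpha><4. (ddy \<alpha> \<bullet> n) *\<^sub>R qcnj (iunit \<alpha>)) = qcnj (snd n)"
  using quat_expansion[of "fst n"] quat_expansion[of "snd n"]
    quat_cnj_expansion[of "fst n"] quat_cnj_expansion[of "snd n"]
  by (simp_all add: ddx_def ddy_def inner_prod_def)

text \<open>The pair \<open>D\<close> of the overview, taken of a linear map, so that the linear
  algebra at a point is separate from differentiation.\<close>

definition dirac :: "(qpoint \<Rightarrow> quat) \<Rightarrow> quat \<times> quat" where
  "dirac L = ((\<Sum>\<alpha><4. iunit \<alpha> * L (ddx \<alpha>)), (\<Sum>\<alpha><4. iunit \<alpha> * L (ddy \<alpha>)))"

text \<open>The quaternionic hermitian product: linear in the second argument for multiplication by
  quaternions from the right.\<close>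

definition qdot :: "quat \<times> quat \<Rightarrow> quat \<times> quat \<Rightarrow> quat" where
  "qdot n D = qcnj (fst n) * fst D + qcnj (snd n) * snd D"

lemma qcnj_mult: "qcnj q * q = of_real (q \<bullet> q)"
  by (simp add: quat_eq_iff qcnj_def times_quat_def of_real_def scaleR_quat_def inner_quat_def one_quat_def algebra_simps)

lemma qdot_self: "qdot n (fst n * c, snd n * c) = (n \<bullet> n) *\<^sub>R c"
  by (simp add: qdot_def inner_prod_def qcnj_mult scaleR_add_left of_real_def flip: mult.assoc)

lemma dirac_wedge:
  "Qext (Dq1 \<and>\<^sub>q d_q1 \<rho> S \<nu> f p) = - (const (f_qbar1 \<rho> S \<nu> f p) * vol4 gx)"
  "Qext (Dq2 \<and>\<^sub>q d_q2 \<rho> S \<nu> f p) = - (const (f_qbar2 \<rho> S \<nu> f p) * vol4 gy)"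
  unfolding Qext_wedge Qext_forms d_q1_def[abs_def] d_q2_def[abs_def] Qext_const_sum dirac_dual
    f_qbar1_def f_qbar2_def by simp_all

lemma form_eq_on_mult_vol4:
  assumes "\<exists>vs\<in>lists T. ev a vs = 1" and "form_eq_on T (ev (- (const q * a))) (\<lambda>vs. 0)"
  shows "q = 0"
proof -
  from assms(1) obtain vs where "vs \<in> lists T" "ev a vs = 1" by blast
  then show ?thesis using assms(2) unfolding form_eq_on_def by force
qed

text \<open>Isolates what the argument at a single point uses. \<open>L\<close> is tied to
  \<open>f\<close> on tangent vectors only, so the derivative of any local extension of
  \<open>f\<close> can take its place.\<close>

locale surface_point =
  fixes \<rho> :: "qpoint \<Rightarrow> real" and S :: "qpoint set" and \<nu> :: "qpoint \<Rightarrow> qpoint"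
    and f :: "qpoint \<Rightarrow> quat" and p :: qpoint and L :: "qpoint \<Rightarrow> quat"
  assumes L: "linear L" 
    and T: "tangent_space \<rho> p = {v. v \<bullet> \<nu> p = 0}" 
    and n: "\<nu> p \<bullet> \<nu> p = 1"
    and diff: "\<And>v. v \<in> tangent_space \<rho> p \<Longrightarrow> surface_diff S f p v = L v"
begin

text \<open>On the tangent space each contraction of \<open>vol\<close> with a coordinate vector is
  a multiple of \<open>contract n vol\<close>, so the 7-form is a single quaternion times it,
  computed in \<open>c\<close>. The minus sign found there matches the one in
  \<open>surface_vol\<close>. By \<open>surface_vol_nonzero\<close> the coefficient is unique, which
  evaluates the definite description.\<close>

lemma f_perp_eq:
  shows "f_perp \<rho> S \<nu> f p = L (\<nu> p) - qdot (\<nu> p) (dirac L)"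
proof -
  define n where "n = \<nu> p"
  let ?T = "{v. v \<bullet> n = 0}"
  let ?\<Phi> = "\<lambda>\<psi>. (\<lambda>vs. (- 1 / 2) *\<^sub>R ((cdq1 \<and>\<^sub>q dq1 \<and>\<^sub>q dy_vol) vs + (dx_vol \<and>\<^sub>q cdq2 \<and>\<^sub>q dq2) vs)) \<and>\<^sub>q one_form \<psi>"
  let ?c = "L n - qdot n (dirac L)"
  let ?D1 = "fst (dirac L)" and ?D2 = "snd (dirac L)"
  have nn: "n \<bullet> n = 1" using n by (simp add: n_def)
  have TT: "tangent_space \<rho> p = ?T" by (simp add: T n_def)
  have c: "(\<Sum>\<delta><4. (ddx \<delta> \<bullet> n) *\<^sub>R (qcnj (iunit \<delta>) * ?D1 - L (ddx \<delta>))) +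
      (\<Sum>\<delta><4. (ddy \<delta> \<bullet> n) *\<^sub>R (qcnj (iunit \<delta>) * ?D2 - L (ddy \<delta>))) = - ?c"
  proof -
    have "L n = (\<Sum>\<delta><4. (ddx \<delta> \<bullet> n) *\<^sub>R L (ddx \<delta>)) + (\<Sum>\<delta><4. (ddy \<delta> \<bullet> n) *\<^sub>R L (ddy \<delta>))"
      using arg_cong[OF qpoint_expansion[of n], of L]
      by (simp add: linear_add[OF L] linear_sum[OF L] linear_scale[OF L])
    moreover have "(\<Sum>\<delta><4. (ddx \<delta> \<bullet> n) *\<^sub>R (qcnj (iunit \<delta>) * ?D1)) = qcnj (fst n) * ?D1"
      "(\<Sum>\<delta><4. (ddy \<delta> \<bullet> n) *\<^sub>R (qcnj (iunit \<delta>) * ?D2)) = qcnj (snd n) * ?D2"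
      unfolding sum_iunit_inner(3,4)[of n, symmetric] by (simp_all add: sum_distrib_right)
    ultimately show ?thesis
      by (simp add: scaleR_diff_right sum_subtractf qdot_def)
  qed
  have val: "?\<Phi> (surface_diff S f p) vs = - ?c * ev (contract n vol) vs" if vs: "vs \<in> lists ?T" for vs
  proof -
    have "?\<Phi> (surface_diff S f p) vs = ?\<Phi> L vs"
      using vs diff unfolding TT
      by (intro wedge_cong_on[of ?T]) (auto simp: one_form_def split: list.split)
    also have "\<dots> = ev (Qext (?\<Phi> L)) vs" by simp
    also have "\<dots> = (\<Sum>\<delta><4. (qcnj (iunit \<delta>) * ?D1 - L (ddx \<delta>)) * ev (contract (ddx \<delta>) vol) vs) +
      (\<Sum>\<delta><4. (qcnj (iunit \<delta>) * ?D2 - L (ddy \<delta>)) * ev (contract (ddy \<delta>) vol) vs)"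
      unfolding volume_decomposition[OF L]
      by (simp add: sum_lessThan_4 contract_vol_ddx contract_vol_ddy dirac_def del: One_nat_def)
    also have "\<dots> = ((\<Sum>\<delta><4. (ddx \<delta> \<bullet> n) *\<^sub>R (qcnj (iunit \<delta>) * ?D1 - L (ddx \<delta>))) +
      (\<Sum>\<delta><4. (ddy \<delta> \<bullet> n) *\<^sub>R (qcnj (iunit \<delta>) * ?D2 - L (ddy \<delta>)))) * ev (contract n vol) vs"
      unfolding contract_vol_restrict[OF nn vs, of "ddx _"] contract_vol_restrict[OF nn vs, of "ddy _"]
      by (simp add: sum_distrib_right distrib_right)
    finally show ?thesis unfolding c .
  qed
  have surf: "surface_vol n vs = - ev (contract n vol) vs" for vs
  proof -
    have "Qext (dx_vol \<and>\<^sub>q dy_vol) = vol" by (simp add: Qext_wedge Qext_forms vol_def)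
    then have "dx_vol \<and>\<^sub>q dy_vol = ev vol" by (metis Qext_inverse UNIV_I)
    then show ?thesis by (simp add: surface_vol_def contract_def)
  qed
  obtain ws r where ws: "ws \<in> lists ?T" and r: "ev (contract n vol) ws = of_real r" "r \<noteq> 0"
    using surface_vol_nonzero[OF nn] by blast
  have "f_perp \<rho> S \<nu> f p = ?c"
    unfolding f_perp_def TT
  proof (rule the_equality)
    show "form_eq_on ?T (?\<Phi> (surface_diff S f p)) (\<lambda>vs. ?c * surface_vol (\<nu> p) vs)"
      unfolding form_eq_on_def using val surf by (simp add: n_def algebra_simps)
  next
    fix c assume "form_eq_on ?T (?\<Phi> (surface_diff S f p)) (\<lambda>vs. c * surface_vol (\<nu> p) vs)"
    then have "- ?c * of_real r = c * - of_real r"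
      unfolding form_eq_on_def using val[OF ws] surf[of ws] ws r(1) by (simp add: n_def)
    then have "?c * of_real r = c * of_real r"
      by (simp only: mult_minus_left mult_minus_right neg_equal_iff_equal)
    then have "r *\<^sub>R ?c = r *\<^sub>R c" by (simp add: of_real_def)
    then show "c = ?c" using r(2) by simp
  qed
  then show ?thesis by (simp add: n_def)
qed

lemma
  shows f_qbar1_eq: "f_qbar1 \<rho> S \<nu> f p = fst (dirac L) - fst (\<nu> p) * qdot (\<nu> p) (dirac L)"
    and f_qbar2_eq: "f_qbar2 \<rho> S \<nu> f p = snd (dirac L) - snd (\<nu> p) * qdot (\<nu> p) (dirac L)"
proof -
  \<comment> \<open>The normal derivative \<open>L (\<nu> p)\<close>, which depends on the
    extension, occurs in the tangential part and in \<open>f_perp\<close> with opposite signs and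
    cancels.\<close>
  have along: "f_along \<rho> S \<nu> f e p = L e - (e \<bullet> \<nu> p) *\<^sub>R qdot (\<nu> p) (dirac L)" for e
  proof -
    have "e - (e \<bullet> \<nu> p) *\<^sub>R \<nu> p \<in> tangent_space \<rho> p" by (simp add: T inner_diff_left n)
    then show ?thesis
      using f_perp_eq
      by (simp add: f_along_def diff linear_diff[OF L] linear_scale[OF L] scaleR_diff_right)
  qed
  show "f_qbar1 \<rho> S \<nu> f p = fst (dirac L) - fst (\<nu> p) * qdot (\<nu> p) (dirac L)"
    unfolding f_qbar1_def along sum_iunit_inner(1)[of "\<nu> p", symmetric] by (simp add: right_diff_distrib sum_subtractf dirac_def sum_distrib_right)
  show "f_qbar2 \<rho> S \<nu> f p = snd (dirac L) - snd (\<nu> p) * qdot (\<nu> p) (dirac L)"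
    unfolding f_qbar2_def along sum_iunit_inner(2)[of "\<nu> p", symmetric] by (simp add: right_diff_distrib sum_subtractf dirac_def sum_distrib_right)
qed

lemma qbar_zero_iff_dirac_forms:
  shows "f_qbar1 \<rho> S \<nu> f p = 0 \<and> f_qbar2 \<rho> S \<nu> f p = 0 \<longleftrightarrow>
     form_eq_on (tangent_space \<rho> p) (Dq1 \<and>\<^sub>q d_q1 \<rho> S \<nu> f p) (\<lambda>vs. 0) \<and>
     form_eq_on (tangent_space \<rho> p) (Dq2 \<and>\<^sub>q d_q2 \<rho> S \<nu> f p) (\<lambda>vs. 0)"
proof -
  let ?f1 = "f_qbar1 \<rho> S \<nu> f p" and ?f2 = "f_qbar2 \<rho> S \<nu> f p" and ?n = "\<nu> p"
  have D1: "Dq1 \<and>\<^sub>q d_q1 \<rho> S \<nu> f p = ev (- (const ?f1 * vol4 gx))"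
    by (metis Qext_inverse UNIV_I dirac_wedge(1))
  have D2: "Dq2 \<and>\<^sub>q d_q2 \<rho> S \<nu> f p = ev (- (const ?f2 * vol4 gy))"
    by (metis Qext_inverse UNIV_I dirac_wedge(2))
  \<comment> \<open>The pair in (b) is \<open>D\<close> minus its projection to the quaternionic
    line of the unit vector \<open>\<nu> p\<close>, hence orthogonal to it.\<close>
  have "qdot ?n (?f1, ?f2) = qdot ?n (dirac L) - qdot ?n (fst ?n * qdot ?n (dirac L), snd ?n * qdot ?n (dirac L))"
    unfolding f_qbar1_eq f_qbar2_eq by (simp add: qdot_def algebra_simps)
  then have orth: "qcnj (fst ?n) * ?f1 + qcnj (snd ?n) * ?f2 = 0"
    by (simp add: qdot_self n) (simp add: qdot_def)
  have cancel: "q = 0" if "qcnj a * q = 0" "a \<noteq> 0" for a q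
  proof -
    have "qcnj (qcnj a) * (qcnj a * q) = (a \<bullet> a) *\<^sub>R q"
      by (simp add: qcnj_mult of_real_def flip: mult.assoc) (simp add: qcnj_def inner_quat_def)
    then show ?thesis using that by simp
  qed
  have "?f1 = 0 \<and> ?f2 = 0"
    if "form_eq_on (tangent_space \<rho> p) (Dq1 \<and>\<^sub>q d_q1 \<rho> S \<nu> f p) (\<lambda>vs. 0)"
      and "form_eq_on (tangent_space \<rho> p) (Dq2 \<and>\<^sub>q d_q2 \<rho> S \<nu> f p) (\<lambda>vs. 0)"
  proof -
    have 1: "?f1 = 0" if "snd ?n \<noteq> 0"
      using form_eq_on_mult_vol4[OF dx_vol_nonzero[OF that]] \<open>form_eq_on _ (Dq1 \<and>\<^sub>q _) _\<close> unfolding D1 T by blast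
    have 2: "?f2 = 0" if "fst ?n \<noteq> 0"
      using form_eq_on_mult_vol4[OF dy_vol_nonzero[OF that]] \<open>form_eq_on _ (Dq2 \<and>\<^sub>q _) _\<close> unfolding D2 T by blast
    \<comment> \<open>If both components are nonzero, facts 1 and 2 suffice. If one is zero, the
      fact for the other component annihilates one of \<open>?f1\<close>, \<open>?f2\<close>, and
      \<open>orth\<close> with \<open>cancel\<close> annihilates the remaining one.\<close>
    have "fst ?n \<noteq> 0 \<or> snd ?n \<noteq> 0" using n by (auto simp: inner_prod_def)
    then show ?thesis using 1 2 orth cancel by (metis add.right_neutral add.left_neutral mult_zero_right)
  qed
  moreover have "form_eq_on X (ev (- (const 0 * a))) (\<lambda>vs. 0)" for X :: "qpoint set" and a
    by (simp add: form_eq_on_def)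
  ultimately show ?thesis unfolding D1 D2 by metis
qed

lemma qbar_zero_iff:
  shows "f_qbar1 \<rho> S \<nu> f p = 0 \<and> f_qbar2 \<rho> S \<nu> f p = 0 \<longleftrightarrow>
     (\<exists>c. dirac L = (fst (\<nu> p) * c, snd (\<nu> p) * c))"
  unfolding f_qbar1_eq f_qbar2_eq
proof safe
  assume "fst (dirac L) - fst (\<nu> p) * qdot (\<nu> p) (dirac L) = 0" "snd (dirac L) - snd (\<nu> p) * qdot (\<nu> p) (dirac L) = 0"
  then show "\<exists>c. dirac L = (fst (\<nu> p) * c, snd (\<nu> p) * c)"
    by (intro exI[of _ "qdot (\<nu> p) (dirac L)"]) (simp add: prod_eq_iff)
qed (simp_all add: qdot_self n)

end

section \<open>Smooth functions\<close>

lemma Ck_on_Suc_differentiable: "Ck_on (Suc k) V F \<Longrightarrow> open V \<Longrightarrow> z \<in> V \<Longrightarrow> (F has_derivative frechet_derivative F (at z)) (at z)"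
  by (simp add: differentiable_on_eq_differentiable_at frechet_derivative_works)

lemma Ck_on_mono_Suc: "Ck_on (Suc k) V F \<Longrightarrow> Ck_on k V F"
  by (induction k arbitrary: F) (auto intro: differentiable_imp_continuous_on)

lemma Ck_on_continuous: "Ck_on k V F \<Longrightarrow> continuous_on V F"
  by (cases k) (auto intro: differentiable_imp_continuous_on)

lemma Ck_on_subset:
  assumes "Ck_on k V F" "W \<subseteq> V"
  shows "Ck_on k W F"
  using assms by (induction k arbitrary: F) (auto intro: continuous_on_subset differentiable_on_subset)

text \<open>On an open set equal functions have equal derivatives, so the induction can pass to the
  derivatives.\<close>

lemma Ck_on_cong:
  assumes "open V" "\<And>z. z \<in> V \<Longrightarrow> F z = G z" "Ck_on k V F"
  shows "Ck_on k V G"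
  using assms(2,3)
proof (induction k arbitrary: F G)
  case 0
  then show ?case using continuous_on_cong by force
next
  case (Suc k)
  have D: "(G has_derivative frechet_derivative F (at z)) (at z)" if "z \<in> V" for z
    using has_derivative_transform_within_open[OF Ck_on_Suc_differentiable[OF Suc.prems(2) \<open>open V\<close> that] \<open>open V\<close> that]
      Suc.prems(1) by blast
  then have "frechet_derivative F (at z) = frechet_derivative G (at z)" if "z \<in> V" for z
    using that by (metis frechet_derivative_at)
  then have "Ck_on k V (\<lambda>z. frechet_derivative G (at z) v)" for v
    using Suc.IH[of "\<lambda>z. frechet_derivative F (at z) v"] Suc.prems(2) by simp
  moreover have "G differentiable_on V"
    using D \<open>open V\<close> by (auto simp: differentiable_on_eq_differentiable_at differentiable_def)
  ultimately show ?case by simp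
qed

text \<open>The introduction rule for the inductions below: an explicit formula for the derivative
  replaces the chosen \<open>frechet_derivative\<close>.\<close>

lemma Ck_on_SucI:
  assumes "open V" "\<And>z. z \<in> V \<Longrightarrow> (F has_derivative F' z) (at z)" "\<And>v. Ck_on k V (\<lambda>z. F' z v)"
  shows "Ck_on (Suc k) V F"
proof -
  have "F differentiable_on V"
    using assms(1,2) by (auto simp: differentiable_on_eq_differentiable_at differentiable_def)
  moreover have "Ck_on k V (\<lambda>z. frechet_derivative F (at z) v)" for v
    using assms by (intro Ck_on_cong[OF assms(1) _ assms(3)[of v]]) (metis frechet_derivative_at)
  ultimately show ?thesis by simp
qed

lemma Ck_on_local:
  assumes "open V" "\<And>z. z \<in> V \<Longrightarrow> \<exists>W. open W \<and> z \<in> W \<and> Ck_on k W F"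
  shows "Ck_on k V F"
  using assms(2)
proof (induction k arbitrary: F)
  case 0
  show ?case unfolding Ck_on.simps
  proof (rule continuous_at_imp_continuous_on, rule ballI)
    fix z assume "z \<in> V"
    then show "continuous (at z) F" using 0[of z] by (auto simp: continuous_on_eq_continuous_at)
  qed
next
  case (Suc k)
  have "(F has_derivative frechet_derivative F (at z)) (at z)" if "z \<in> V" for z
    using Suc.prems[OF that] Ck_on_Suc_differentiable by blast
  moreover have "Ck_on k V (\<lambda>z. frechet_derivative F (at z) v)" for v
    using Suc.prems by (intro Suc.IH) (metis Ck_on.simps(2))
  ultimately show ?case by (intro Ck_on_SucI[OF assms(1)])
qed

lemma Ck_on_const: "Ck_on k V (\<lambda>z. c)"
  by (induction k arbitrary: c) simp_all

lemma Ck_on_bounded_linear: "open V \<Longrightarrow> bounded_linear h \<Longrightarrow> Ck_on k V h"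
  by (cases k)
    (auto intro: linear_continuous_on Ck_on_SucI[OF _ bounded_linear_imp_has_derivative] Ck_on_const
      simp del: Ck_on.simps(2))

lemma Ck_on_bounded_linear_compose:
  assumes "open V" "bounded_linear h" "Ck_on k V F"
  shows "Ck_on k V (\<lambda>z. h (F z))"
  using assms(3)
proof (induction k arbitrary: F)
  case 0
  then show ?case using bounded_linear.continuous_on[OF assms(2)] by simp
next
  case (Suc k)
  show ?case
    by (rule Ck_on_SucI[OF assms(1) bounded_linear.has_derivative[OF assms(2) Ck_on_Suc_differentiable[OF Suc.prems assms(1)]]])
      (use Suc in auto)
qed

lemma Ck_on_add:
  assumes "open V" "Ck_on k V F" "Ck_on k V G"
  shows "Ck_on k V (\<lambda>z. F z + G z)"
  using assms(2,3)
proof (induction k arbitrary: F G)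
  case 0
  then show ?case by (simp add: continuous_on_add)
next
  case (Suc k)
  show ?case
    by (rule Ck_on_SucI[OF assms(1) has_derivative_add[OF Ck_on_Suc_differentiable[OF Suc.prems(1) assms(1)]
            Ck_on_Suc_differentiable[OF Suc.prems(2) assms(1)]]])
      (use Suc in auto)
qed

text \<open>One proof for scalar multiples, algebra products and inner products.\<close>

lemma (in bounded_bilinear) Ck_on:
  assumes "open V" "Ck_on k V F" "Ck_on k V G"
  shows "Ck_on k V (\<lambda>z. prod (F z) (G z))"
  using assms(2,3)
proof (induction k arbitrary: F G)
  case 0
  then show ?case by (simp add: continuous_on)
next
  case (Suc k)
  show ?case
  proof (rule Ck_on_SucI[OF assms(1) FDERIV[OF Ck_on_Suc_differentiable[OF Suc.prems(1) assms(1)]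
            Ck_on_Suc_differentiable[OF Suc.prems(2) assms(1)]]])
    show "Ck_on k V (\<lambda>z. prod (F z) (frechet_derivative G (at z) v) + prod (frechet_derivative F (at z) v) (G z))" for v
      using Suc.prems by (intro Ck_on_add[OF assms(1)] Suc.IH Ck_on_mono_Suc[of k V F] Ck_on_mono_Suc[of k V G]) auto
  qed auto
qed

text \<open>The derivative of the inverse is a product that contains the inverse itself, which the
  induction hypothesis controls to one order less.\<close>

lemma Ck_on_inverse:
  fixes F :: "'a::euclidean_space \<Rightarrow> real"
  assumes "open V" "Ck_on k V F" "\<And>z. z \<in> V \<Longrightarrow> F z \<noteq> 0"
  shows "Ck_on k V (\<lambda>z. inverse (F z))"
  using assms(2)
proof (induction k)
  case 0
  then show ?case using assms(3) by (simp add: continuous_on_inverse)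
next
  case (Suc k)
  show ?case
  proof (rule Ck_on_SucI[OF assms(1) Deriv.has_derivative_inverse[OF assms(3) Ck_on_Suc_differentiable[OF Suc.prems assms(1)]]])
    have "Ck_on k V (\<lambda>z. inverse (F z))" using Suc Ck_on_mono_Suc by blast
    then show "Ck_on k V (\<lambda>z. - (inverse (F z) * frechet_derivative F (at z) v * inverse (F z)))" for v
      using Suc.prems
      by (intro Ck_on_bounded_linear_compose[OF assms(1) bounded_linear_minus[OF bounded_linear_ident]]
          bounded_bilinear.Ck_on[OF bounded_bilinear_mult assms(1)]) auto
  qed auto
qed

lemma Ck_on_sum:
  assumes "open V" "\<And>i. i \<in> I \<Longrightarrow> Ck_on k V (F i)"
  shows "Ck_on k V (\<lambda>z. \<Sum>i\<in>I. F i z)"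
  using assms(2)
  by (induction I rule: infinite_finite_induct) (simp_all add: Ck_on_const Ck_on_add[OF assms(1)])

lemma Ck_on_compose:
  fixes F :: "'b::euclidean_space \<Rightarrow> 'c::real_normed_vector" and G :: "'a::euclidean_space \<Rightarrow> 'b"
  assumes "open V" "open W" "\<And>z. z \<in> V \<Longrightarrow> G z \<in> W" "Ck_on k W F" "Ck_on k V G"
  shows "Ck_on k V (\<lambda>z. F (G z))"
  using assms(4,5)
proof (induction k arbitrary: F)
  case 0
  then show ?case using assms(3) by (auto intro: continuous_on_compose2[of W F V G])
next
  case (Suc k)
  \<comment> \<open>The direction in the chain rule varies with \<open>z\<close>, whereas
    \<open>Ck_on\<close> speaks of fixed directions; expansion in the basis moves the dependence on
    \<open>z\<close> into scalar coefficients.\<close>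
  have expand: "frechet_derivative F (at (G z)) w = (\<Sum>b\<in>Basis. (w \<bullet> b) *\<^sub>R frechet_derivative F (at (G z)) b)"
    if "z \<in> V" for z w
  proof -
    have "linear (frechet_derivative F (at (G z)))"
      using Ck_on_Suc_differentiable[OF Suc.prems(1) assms(2) assms(3)[OF that]] has_derivative_linear by blast
    from linear_sum[OF this, of "\<lambda>b. (w \<bullet> b) *\<^sub>R b" Basis] show ?thesis
      by (simp add: euclidean_representation linear_scale[OF \<open>linear _\<close>])
  qed
  have "((\<lambda>z. F (G z)) has_derivative (\<lambda>v. \<Sum>b\<in>Basis. (frechet_derivative G (at z) v \<bullet> b) *\<^sub>R frechet_derivative F (at (G z)) b)) (at z)"
    if "z \<in> V" for z
    unfolding expand[OF that, symmetric]
    using Ck_on_Suc_differentiable[OF Suc.prems(1) assms(2) assms(3)[OF that]]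
      Ck_on_Suc_differentiable[OF Suc.prems(2) assms(1) that]
    by (rule has_derivative_compose[rotated])
  then show ?case
  proof (rule Ck_on_SucI[OF assms(1)])
    fix v
    have "Ck_on k V (\<lambda>z. frechet_derivative F (at (G z)) b)" for b
      using Suc.prems Ck_on_mono_Suc by (intro Suc.IH) auto
    moreover have "Ck_on k V (\<lambda>z. frechet_derivative G (at z) v \<bullet> b)" for b
      using Suc.prems by (intro Ck_on_bounded_linear_compose[OF assms(1) bounded_linear_inner_left]) auto
    ultimately show "Ck_on k V (\<lambda>z. \<Sum>b\<in>Basis. (frechet_derivative G (at z) v \<bullet> b) *\<^sub>R frechet_derivative F (at (G z)) b)"
      by (intro Ck_on_sum[OF assms(1)] bounded_bilinear.Ck_on[OF bounded_bilinear_scaleR assms(1)])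
  qed
qed

lemma smooth_on_const: "smooth_on V (\<lambda>z. c)"
  by (simp add: smooth_on_def Ck_on_const)

lemma smooth_on_subset: "smooth_on V F \<Longrightarrow> W \<subseteq> V \<Longrightarrow> smooth_on W F"
  by (meson smooth_on_def Ck_on_subset)

lemma smooth_on_cong: "open V \<Longrightarrow> (\<And>z. z \<in> V \<Longrightarrow> F z = G z) \<Longrightarrow> smooth_on V F \<Longrightarrow> smooth_on V G"
  by (metis smooth_on_def Ck_on_cong)

lemma smooth_on_local:
  "open V \<Longrightarrow> (\<And>z. z \<in> V \<Longrightarrow> \<exists>W. open W \<and> z \<in> W \<and> smooth_on W F) \<Longrightarrow> smooth_on V F"
  unfolding smooth_on_def by (intro allI Ck_on_local) meson+

lemma smooth_on_continuous: "smooth_on V F \<Longrightarrow> continuous_on V F"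
  by (meson smooth_on_def Ck_on_continuous)

lemma smooth_on_derivative: "smooth_on V F \<Longrightarrow> smooth_on V (\<lambda>z. frechet_derivative F (at z) v)"
  by (metis smooth_on_def Ck_on.simps(2))

lemma smooth_on_has_derivative:
  "smooth_on V F \<Longrightarrow> open V \<Longrightarrow> z \<in> V \<Longrightarrow> (F has_derivative frechet_derivative F (at z)) (at z)"
  unfolding smooth_on_def using Ck_on_Suc_differentiable by blast

lemma smooth_on_bounded_linear: "open V \<Longrightarrow> bounded_linear h \<Longrightarrow> smooth_on V F \<Longrightarrow> smooth_on V (\<lambda>z. h (F z))"
  by (simp add: smooth_on_def Ck_on_bounded_linear_compose)

lemma smooth_on_ident: "open V \<Longrightarrow> smooth_on V (\<lambda>z. z)"
  by (simp add: smooth_on_def Ck_on_bounded_linear)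

lemma smooth_on_add: "open V \<Longrightarrow> smooth_on V F \<Longrightarrow> smooth_on V G \<Longrightarrow> smooth_on V (\<lambda>z. F z + G z)"
  by (simp add: smooth_on_def Ck_on_add)

lemma smooth_on_minus: "open V \<Longrightarrow> smooth_on V F \<Longrightarrow> smooth_on V (\<lambda>z. - F z)"
  by (rule smooth_on_bounded_linear[OF _ bounded_linear_minus[OF bounded_linear_ident]])

lemma smooth_on_diff: "open V \<Longrightarrow> smooth_on V F \<Longrightarrow> smooth_on V G \<Longrightarrow> smooth_on V (\<lambda>z. F z - G z)"
  using smooth_on_add[of V F "\<lambda>z. - G z"] smooth_on_minus by auto

lemma smooth_on_sum: "open V \<Longrightarrow> (\<And>i. i \<in> I \<Longrightarrow> smooth_on V (F i)) \<Longrightarrow> smooth_on V (\<lambda>z. \<Sum>i\<in>I. F i z)"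
  by (simp add: smooth_on_def Ck_on_sum)

lemma smooth_on_scaleR: "open V \<Longrightarrow> smooth_on V F \<Longrightarrow> smooth_on V G \<Longrightarrow> smooth_on V (\<lambda>z. F z *\<^sub>R G z)"
  by (simp add: smooth_on_def bounded_bilinear.Ck_on[OF bounded_bilinear_scaleR])

lemma smooth_on_mult:
  fixes F G :: "'a::euclidean_space \<Rightarrow> 'b::real_normed_algebra"
  shows "open V \<Longrightarrow> smooth_on V F \<Longrightarrow> smooth_on V G \<Longrightarrow> smooth_on V (\<lambda>z. F z * G z)"
  by (simp add: smooth_on_def bounded_bilinear.Ck_on[OF bounded_bilinear_mult])

lemma smooth_on_prod:
  fixes F :: "'i \<Rightarrow> 'a::euclidean_space \<Rightarrow> real"
  shows "open V \<Longrightarrow> (\<And>i. i \<in> I \<Longrightarrow> smooth_on V (F i)) \<Longrightarrow> smooth_on V (\<lambda>z. \<Prod>i\<in>I. F i z)"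
  by (induction I rule: infinite_finite_induct) (simp_all add: smooth_on_const smooth_on_mult)

lemma smooth_on_inverse:
  fixes F :: "'a::euclidean_space \<Rightarrow> real"
  shows "open V \<Longrightarrow> smooth_on V F \<Longrightarrow> (\<And>z. z \<in> V \<Longrightarrow> F z \<noteq> 0) \<Longrightarrow> smooth_on V (\<lambda>z. inverse (F z))"
  by (simp add: smooth_on_def Ck_on_inverse)

lemma smooth_on_compose:
  fixes F :: "'b::euclidean_space \<Rightarrow> 'c::real_normed_vector" and G :: "'a::euclidean_space \<Rightarrow> 'b"
  shows "open V \<Longrightarrow> open W \<Longrightarrow> (\<And>z. z \<in> V \<Longrightarrow> G z \<in> W) \<Longrightarrow> smooth_on W F \<Longrightarrow> smooth_on V G \<Longrightarrow> smooth_on V (\<lambda>z. F (G z))"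
  unfolding smooth_on_def using Ck_on_compose by blast

lemma smooth_on_Pair:
  fixes F :: "'a::euclidean_space \<Rightarrow> 'b::real_normed_vector" and G :: "'a \<Rightarrow> 'c::real_normed_vector"
  assumes "open V" "smooth_on V F" "smooth_on V G"
  shows "smooth_on V (\<lambda>z. (F z, G z))"
proof -
  have "bounded_linear (\<lambda>x. (x, 0))" "bounded_linear (\<lambda>y. (0, y))"
    by (intro bounded_linear_Pair bounded_linear_ident bounded_linear_zero)+
  then have "smooth_on V (\<lambda>z. (F z, 0) + (0, G z))"
    using assms by (intro smooth_on_add) (auto intro: smooth_on_bounded_linear)
  then show ?thesis by simp
qed

section \<open>Smooth cutoff functions and extension from the hypersurface\<close>

definition flat_exp :: "nat \<Rightarrow> real \<Rightarrow> real" where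
  "flat_exp n x = (if 0 < x then inverse x ^ n * exp (- inverse x) else 0)"

lemma flat_exp_tendsto_0: "(flat_exp n \<longlongrightarrow> 0) (at_right 0)"
proof -
  have "((\<lambda>y. y ^ n / exp y) \<longlongrightarrow> (0::real)) at_top"
    by (rule tendsto_power_div_exp_0)
  then have "((\<lambda>x. inverse x ^ n / exp (inverse x)) \<longlongrightarrow> (0::real)) (at_right 0)"
    using filterlim_compose filterlim_inverse_at_top_right by blast
  moreover have "\<forall>\<^sub>F x in at_right 0. inverse x ^ n / exp (inverse x) = flat_exp n x"
    using eventually_at_right_less[of 0]
    by eventually_elim (simp add: flat_exp_def exp_minus divide_inverse)
  ultimately show ?thesis by (rule Lim_transform_eventually)
qed

lemma flat_exp_deriv:
  "(flat_exp n has_real_derivative flat_exp (n + 2) x - of_nat n * flat_exp (n + 1) x) (at x)"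
proof -
  consider "x < 0" | "x > 0" | "x = 0" by linarith
  then show ?thesis
  proof cases
    case 1
    have "((\<lambda>x. 0) has_real_derivative 0) (at x)" by simp
    then have "(flat_exp n has_real_derivative 0) (at x)"
      by (rule has_field_derivative_transform_within_open[of _ _ _ "{..<0}"]) (use 1 in \<open>auto simp: flat_exp_def\<close>)
    then show ?thesis using 1 by (simp add: flat_exp_def)
  next
    case 2
    have "((\<lambda>x. exp (- inverse x)) has_real_derivative exp (- inverse x) * (inverse x)\<^sup>2) (at x)"
      using 2 by (auto intro!: derivative_eq_intros simp: power2_eq_square)
    moreover have "((\<lambda>x. inverse x ^ n) has_real_derivative - of_nat n * inverse x ^ (n + 1)) (at x)"
    proof (rule DERIV_cong)
      show "((\<lambda>x. inverse x ^ n) has_real_derivative of_nat n * (- (inverse x ^ Suc (Suc 0)) * inverse x ^ (n - Suc 0))) (at x)"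
        using 2 by (intro DERIV_power DERIV_inverse) simp
    qed (cases n; simp add: algebra_simps)
    ultimately have "((\<lambda>x. inverse x ^ n * exp (- inverse x)) has_real_derivative
       flat_exp (n + 2) x - of_nat n * flat_exp (n + 1) x) (at x)"
      using 2 by (auto dest: DERIV_mult simp: flat_exp_def power_add power2_eq_square algebra_simps)
    then show ?thesis
      by (rule has_field_derivative_transform_within_open[of _ _ _ "{0<..}"]) (use 2 in \<open>auto simp: flat_exp_def\<close>)
  next
    case 3
    \<comment> \<open>From the right the difference quotient at 0 is \<open>flat_exp (Suc n)\<close>
      itself, which tends to 0; from the left it is 0.\<close>
    have right: "((\<lambda>y. (flat_exp n y - flat_exp n 0) / (y - 0)) \<longlongrightarrow> 0) (at_right 0)"
    proof (rule Lim_transform_eventually[OF flat_exp_tendsto_0[of "Suc n"]])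
      show "\<forall>\<^sub>F y in at_right 0. flat_exp (Suc n) y = (flat_exp n y - flat_exp n 0) / (y - 0)"
        using eventually_at_right_less[of 0]
        by eventually_elim (simp add: flat_exp_def divide_inverse mult_ac)
    qed
    have left: "((\<lambda>y. (flat_exp n y - flat_exp n 0) / (y - 0)) \<longlongrightarrow> 0) (at_left 0)"
    proof (rule Lim_transform_eventually[OF tendsto_const])
      show "\<forall>\<^sub>F y in at_left 0. 0 = (flat_exp n y - flat_exp n 0) / (y - 0)"
        using eventually_at_left_field[of _ 0]
        by (simp add: flat_exp_def eventually_at_left_field exI[of _ "-1"])
    qed
    have "(flat_exp n has_real_derivative 0) (at 0)"
      unfolding has_field_derivative_iff using left right by (simp add: filterlim_split_at)
    then show ?thesis using 3 by (simp add: flat_exp_def)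
  qed
qed

text \<open>The derivative of a member of the family is a combination of members with larger
  exponents, so all exponents are treated in one induction on the order.\<close>

lemma smooth_flat_exp: "smooth_on UNIV (flat_exp n)"
  unfolding smooth_on_def
proof
  show "Ck_on k UNIV (flat_exp n)" for k
  proof (induction k arbitrary: n)
    case 0
    have "isCont (flat_exp n) x" for x using flat_exp_deriv by (rule DERIV_isCont)
    then show ?case by (simp add: continuous_at_imp_continuous_on)
  next
    case (Suc k)
    show ?case
    proof (rule Ck_on_SucI[OF open_UNIV])
      show "(flat_exp n has_derivative (\<lambda>v. (flat_exp (n + 2) x + (- of_nat n) * flat_exp (n + 1) x) * v)) (at x)" for x
        using flat_exp_deriv[of n x] by (simp add: has_field_derivative_def)
      show "Ck_on k UNIV (\<lambda>x. (flat_exp (n + 2) x + (- of_nat n) * flat_exp (n + 1) x) * v)" for v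
        by (intro bounded_bilinear.Ck_on[OF bounded_bilinear_mult] Ck_on_add Ck_on_const Suc.IH open_UNIV)
    qed
  qed
qed

text \<open>The quotient a / (a + b), where \<open>a\<close> is positive exactly inside the ball of
  radius \<open>2 * r\<close> and \<open>b\<close> exactly outside the closed ball of radius
  \<open>r\<close>. These regions cover the space, so the denominator never vanishes. The squared
  distance is used because it is smooth at the centre too.\<close>

lemma smooth_bump:
  fixes p :: "'a::euclidean_space"
  assumes "0 < r"
  obtains \<phi> :: "'a \<Rightarrow> real" where "smooth_on UNIV \<phi>" "\<And>z. z \<in> ball p r \<Longrightarrow> \<phi> z = 1"
    "\<And>z. z \<notin> ball p (2 * r) \<Longrightarrow> \<phi> z = 0"
proof -
  define q where "q z = (z - p) \<bullet> (z - p)" for z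
  define a where "a z = flat_exp 0 (4 * r\<^sup>2 - q z)" for z
  define b where "b z = flat_exp 0 (q z - r\<^sup>2)" for z
  have q: "q z = (dist p z)\<^sup>2" for z
    unfolding q_def by (metis dist_commute dist_norm power2_norm_eq_inner)
  have pos: "a z + b z \<noteq> 0" for z
  proof -
    have "0 < 4 * r\<^sup>2 - q z \<or> 0 < q z - r\<^sup>2" using assms by (smt (verit) zero_less_power)
    then have "0 < a z \<or> 0 < b z" by (auto simp: a_def b_def flat_exp_def)
    moreover have "0 \<le> a z" "0 \<le> b z" by (auto simp: a_def b_def flat_exp_def)
    ultimately show ?thesis by linarith
  qed
  have "smooth_on UNIV q"
    unfolding q_def smooth_on_def
    using smooth_on_diff[OF open_UNIV smooth_on_ident smooth_on_const]
    by (auto intro!: bounded_bilinear.Ck_on[OF bounded_bilinear_inner open_UNIV] simp: smooth_on_def)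
  then have "smooth_on UNIV (\<lambda>z. 4 * r\<^sup>2 - q z)" "smooth_on UNIV (\<lambda>z. q z - r\<^sup>2)"
    by (intro smooth_on_diff smooth_on_const open_UNIV; assumption)+
  note this[THEN smooth_on_compose[OF open_UNIV open_UNIV UNIV_I smooth_flat_exp[of 0]]]
  then have "smooth_on UNIV a" "smooth_on UNIV b"
    unfolding a_def b_def by simp_all
  then have "smooth_on UNIV (\<lambda>z. a z * inverse (a z + b z))"
    using pos by (intro smooth_on_mult smooth_on_inverse smooth_on_add open_UNIV)
  moreover have "a z * inverse (a z + b z) = 1" if "z \<in> ball p r" for z
  proof -
    have "(dist p z)\<^sup>2 < r\<^sup>2" using that power_strict_mono[of "dist p z" r 2] by simp
    then have "b z = 0" by (simp add: b_def flat_exp_def q)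
    then show ?thesis using pos[of z] by simp
  qed
  moreover have "a z * inverse (a z + b z) = 0" if "z \<notin> ball p (2 * r)" for z
  proof -
    have "(2 * r)\<^sup>2 \<le> (dist p z)\<^sup>2" using that assms by (intro power_mono) auto
    then have "a z = 0" by (simp add: a_def flat_exp_def q power_mult_distrib)
    then show ?thesis by simp
  qed
  ultimately show thesis by (rule that)
qed

text \<open>
  The products \<open>\<phi>\<^sub>j \<Prod>\<^sub>i\<^sub><\<^sub>j (1 - \<phi>\<^sub>i)\<close> of bump functions telescope to a partition of unity, and on the ball
  where \<open>\<phi>\<^sub>i = 1\<close> all those with \<open>j > i\<close> vanish.
\<close>

lemma smooth_on_surface_extension:
  fixes f :: "'a::euclidean_space \<Rightarrow> 'b::real_normed_vector"
  assumes "smooth_on_surface S f"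
  obtains V F where "open V" "S \<subseteq> V" "smooth_on V F" "\<And>z. z \<in> S \<Longrightarrow> F z = f z"
proof (cases "S = {}")
  case True
  moreover have "smooth_on {} f" by (rule smooth_on_local) auto
  ultimately show thesis using that[of "{}" f] by simp
next
  case False
  define Q where "Q p r W F \<longleftrightarrow> 0 < r \<and> open W \<and> cball p (2 * r) \<subseteq> W \<and> smooth_on W F \<and> (\<forall>z\<in>S \<inter> W. F z = f z)"
    for p and r :: real and W F
  have "\<exists>r W F. Q p r W F" if "p \<in> S" for p
  proof -
    from assms[unfolded smooth_on_surface_def, rule_format, OF that]
    obtain W F where W: "open W" "p \<in> W" "smooth_on W F" "\<forall>z\<in>S \<inter> W. F z = f z"
      by (elim exE conjE)
    then obtain e where "0 < e" "cball p e \<subseteq> W" using open_contains_cball by blast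
    then have "Q p (e / 2) W F" using W by (simp add: Q_def)
    then show ?thesis by blast
  qed
  then obtain r W F where "\<And>p. p \<in> S \<Longrightarrow> Q p (r p) (W p) (F p)"
    by metis
  then have rWF: "0 < r p" "open (W p)" "cball p (2 * r p) \<subseteq> W p" "smooth_on (W p) (F p)"
    "\<And>z. z \<in> S \<Longrightarrow> z \<in> W p \<Longrightarrow> F p z = f z" if "p \<in> S" for p
    using that unfolding Q_def by blast+
  have "\<And>B. B \<in> (\<lambda>p. ball p (r p)) ` S \<Longrightarrow> open B" by auto
  then obtain \<B> where \<B>: "\<B> \<subseteq> (\<lambda>p. ball p (r p)) ` S" "countable \<B>" "\<Union>\<B> = \<Union>((\<lambda>p. ball p (r p)) ` S)"
    by (rule Lindelof)
  from \<B>(1,2) have "countable \<B> \<and> \<B> \<subseteq> (\<lambda>p. ball p (r p)) ` S" by simp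
  then obtain C where C: "C \<subseteq> S" "countable C" "\<B> = (\<lambda>p. ball p (r p)) ` C"
    unfolding countable_subset_image by (elim exE conjE)
  have cover: "S \<subseteq> (\<Union>p\<in>C. ball p (r p))"
    using \<B>(3) C(3) rWF(1) by fastforce
  then have "C \<noteq> {}" using False by auto
  \<comment> \<open>If \<open>C\<close> is finite, the sequence repeats its values; the telescoping
    sum does not ask for distinct centres.\<close>
  define c where "c = from_nat_into C"
  have c: "c i \<in> S" for i using from_nat_into[OF \<open>C \<noteq> {}\<close>] C(1) by (auto simp: c_def)
  have range_c: "range c = C" unfolding c_def using \<open>C \<noteq> {}\<close> C(2) by (rule range_from_nat_into)
  have "\<exists>\<phi>. smooth_on UNIV \<phi> \<and> (\<forall>z\<in>ball (c i) (r (c i)). \<phi> z = (1::real)) \<and> (\<forall>z. z \<notin> ball (c i) (2 * r (c i)) \<longrightarrow> \<phi> z = 0)" for i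
    using smooth_bump[OF rWF(1)[OF c[of i]], of "c i"] by metis
  then obtain \<phi> where \<phi>: "\<And>i. smooth_on UNIV (\<phi> i)"
    and \<phi>1: "\<And>i z. z \<in> ball (c i) (r (c i)) \<Longrightarrow> \<phi> i z = (1::real)"
    and \<phi>0: "\<And>i z. z \<notin> ball (c i) (2 * r (c i)) \<Longrightarrow> \<phi> i z = 0"
    by metis
  \<comment> \<open>\<open>H i\<close> is smooth on \<open>W (c i)\<close> and vanishes off the
    closed ball of radius \<open>2 * r (c i)\<close>, which lies in \<open>W (c i)\<close>; these
    two open sets cover the space.\<close>
  define H where "H i z = (if z \<in> W (c i) then \<phi> i z *\<^sub>R F (c i) z else 0)" for i z
  have H: "smooth_on UNIV (H i)" for i
  proof (rule smooth_on_local[OF open_UNIV])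
    fix z
    note i = rWF[OF c[of i]]
    show "\<exists>V. open V \<and> z \<in> V \<and> smooth_on V (H i)"
    proof (cases "z \<in> W (c i)")
      case True
      have "smooth_on (W (c i)) (\<lambda>z. \<phi> i z *\<^sub>R F (c i) z)"
        using i \<phi>[of i] by (intro smooth_on_scaleR) (auto intro: smooth_on_subset)
      then have "smooth_on (W (c i)) (H i)"
        using i by (elim smooth_on_cong[rotated 2]) (auto simp: H_def)
      then show ?thesis using i True by blast
    next
      case False
      have "smooth_on (- cball (c i) (2 * r (c i))) (H i)"
        by (rule smooth_on_cong[OF _ _ smooth_on_const[of _ 0]]) (auto simp: H_def \<phi>0)
      then show ?thesis using i False by (intro exI[of _ "- cball (c i) (2 * r (c i))"]) auto
    qed
  qed
  define P where "P m z = (\<Sum>j\<le>m. (\<Prod>i<j. 1 - \<phi> i z) *\<^sub>R H j z)" for m z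
  have P: "smooth_on UNIV (P m)" for m
    unfolding P_def
    by (intro smooth_on_sum smooth_on_scaleR smooth_on_prod smooth_on_diff smooth_on_const \<phi> H open_UNIV)
  have stable: "P m z = P k z" if "z \<in> ball (c k) (r (c k))" "k \<le> m" for m k z
    unfolding P_def
  proof (rule sum.mono_neutral_right)
    show "\<forall>j\<in>{..m} - {..k}. (\<Prod>i<j. 1 - \<phi> i z) *\<^sub>R H j z = 0"
    proof
      fix j assume "j \<in> {..m} - {..k}"
      then have "(\<Prod>i<j. 1 - \<phi> i z) = 0"
        using \<phi>1[OF that(1)] by (intro prod_zero bexI[of _ k]) auto
      then show "(\<Prod>i<j. 1 - \<phi> i z) *\<^sub>R H j z = 0" by simp
    qed
  qed (use that in auto)
  have P_f: "P m z = (1 - (\<Prod>i\<le>m. 1 - \<phi> i z)) *\<^sub>R f z" if "z \<in> S" for m z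
  proof -
    have Hf: "H j z = \<phi> j z *\<^sub>R f z" for j
    proof (cases "z \<in> W (c j)")
      case True
      then show ?thesis using rWF(5)[OF c[of j] that] by (simp add: H_def)
    next
      case False
      then have "z \<notin> ball (c j) (2 * r (c j))" using rWF(3)[OF c[of j]] ball_subset_cball by blast
      then show ?thesis using False \<phi>0 by (simp add: H_def)
    qed
    show ?thesis
      by (induction m) (simp_all add: P_def Hf algebra_simps prod.atMost_Suc lessThan_Suc_atMost)
  qed
  define V where "V = (\<Union>i. ball (c i) (r (c i)))"
  \<comment> \<open>The partial sums are stopped at the first ball containing \<open>z\<close>. By
    \<open>stable\<close>, any other ball containing \<open>z\<close> gives the same value, so
    locally the extension is a single smooth \<open>P k\<close>.\<close>
  define N where "N z = (LEAST i. z \<in> ball (c i) (r (c i)))" for z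
  have N: "z \<in> ball (c (N z)) (r (c (N z)))" if "z \<in> V" for z
    unfolding N_def by (rule LeastI_ex) (use that in \<open>auto simp: V_def\<close>)
  have PN: "P (N z) z = P k z" if "z \<in> ball (c k) (r (c k))" for k z
  proof -
    have "N z \<le> k" unfolding N_def using that by (rule Least_le)
    moreover have "z \<in> V" using that by (auto simp: V_def)
    ultimately show ?thesis using stable N by metis
  qed
  show thesis
  proof (rule that[of V "\<lambda>z. P (N z) z"])
    show V: "open V" by (auto simp: V_def)
    show SV: "S \<subseteq> V" using cover range_c unfolding V_def by blast
    show "smooth_on V (\<lambda>z. P (N z) z)"
    proof (rule smooth_on_local[OF V])
      fix z assume "z \<in> V"
      then obtain k where k: "z \<in> ball (c k) (r (c k))" by (auto simp: V_def)
      have "smooth_on (ball (c k) (r (c k))) (\<lambda>z. P (N z) z)"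
        by (rule smooth_on_cong[OF open_ball _ smooth_on_subset[OF P[of k] subset_UNIV]]) (simp add: PN)
      then show "\<exists>W. open W \<and> z \<in> W \<and> smooth_on W (\<lambda>z. P (N z) z)" using k by blast
    qed
    show "P (N z) z = f z" if "z \<in> S" for z
    proof -
      have "\<phi> (N z) z = 1" using N SV that \<phi>1 by blast
      then have 0: "(\<Prod>i\<le>N z. 1 - \<phi> i z) = 0" by (intro prod_zero) auto
      show ?thesis unfolding P_f[OF that] 0 by simp
    qed
  qed
qed

section \<open>Division by a defining function\<close>

text \<open>For a unit vector \<open>e\<close> the inner map multiplies the coordinate along
  \<open>e\<close> by \<open>t\<close>. Differentiating under the integral gives integrals of the
  same shape for derivatives of \<open>h\<close>, with weights \<open>\<phi> t\<close> and
  \<open>\<phi> t * (1 - t)\<close>; the arbitrary weight \<open>\<phi>\<close> is what lets the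
  induction close.\<close>

lemma Ck_on_integral_shrink:
  fixes h :: "'a::euclidean_space \<Rightarrow> 'b::euclidean_space" and e :: 'a
  assumes V: "open V" "convex V" "\<And>y t. y \<in> V \<Longrightarrow> t \<in> {0..1} \<Longrightarrow> y - ((1 - t) * (y \<bullet> e)) *\<^sub>R e \<in> V"
    and "continuous_on {0..1} \<phi>" and "Ck_on k V h"
  shows "Ck_on k V (\<lambda>y. integral {0..1} (\<lambda>t. \<phi> t *\<^sub>R h (y - ((1 - t) * (y \<bullet> e)) *\<^sub>R e)))"
  using assms(4,5)
proof (induction k arbitrary: \<phi> h)
  let ?s = "\<lambda>t y. y - ((1 - t) * (y \<bullet> e)) *\<^sub>R e"
  have cont: "continuous_on (V \<times> cbox 0 1) (\<lambda>(y, t). \<phi> t *\<^sub>R h (?s t y))"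
    if "continuous_on {0..1} \<phi>" "continuous_on V h" for \<phi> and h :: "'a \<Rightarrow> 'b"
    unfolding split_beta
  proof (intro continuous_intros)
    show "continuous_on (V \<times> cbox 0 1) (\<lambda>x. \<phi> (snd x))"
      by (rule continuous_on_compose2[OF that(1)]) (auto intro: continuous_intros)
    show "continuous_on (V \<times> cbox 0 1) (\<lambda>x. h (?s (snd x) (fst x)))"
      by (rule continuous_on_compose2[OF that(2)]) (use V(3) in \<open>auto intro!: continuous_intros\<close>)
  qed
  {
    case 0
    then show ?case
      using integral_continuous_on_param[OF cont] by simp
  next
    case (Suc k)
    define D where "D y t v = \<phi> t *\<^sub>R frechet_derivative h (at (?s t y)) (?s t v)" for y t v
    have hD: "(h has_derivative frechet_derivative h (at (?s t y))) (at (?s t y))" if "y \<in> V" "t \<in> {0..1}" for y t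
      using Ck_on_Suc_differentiable[OF Suc.prems(2) V(1) V(3)[OF that]] .
    have Dd: "((\<lambda>y. \<phi> t *\<^sub>R h (?s t y)) has_derivative D y t) (at y)" if "y \<in> V" "t \<in> {0..1}" for y t
    proof -
      have "(?s t has_derivative ?s t) (at y)"
        by (intro bounded_linear_imp_has_derivative bounded_linear_sub bounded_linear_ident
            bounded_linear_compose[OF bounded_linear_scaleR_left]
            bounded_linear_compose[OF bounded_linear_mult_right] bounded_linear_inner_left)
      from has_derivative_compose[OF this hD[OF that]] show ?thesis
        unfolding D_def by (intro has_derivative_scaleR_right)
    qed
    have Dexp: "D y t v = \<phi> t *\<^sub>R frechet_derivative h (at (?s t y)) v
        - (v \<bullet> e) *\<^sub>R ((\<phi> t * (1 - t)) *\<^sub>R frechet_derivative h (at (?s t y)) e)"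
      if "y \<in> V" "t \<in> {0..1}" for y t v
    proof -
      interpret bounded_linear "frechet_derivative h (at (?s t y))"
        using hD[OF that] by (rule has_derivative_bounded_linear)
      have "frechet_derivative h (at (?s t y)) (?s t v) = frechet_derivative h (at (?s t y)) v
          - ((1 - t) * (v \<bullet> e)) *\<^sub>R frechet_derivative h (at (?s t y)) e"
        by (simp only: diff scaleR)
      then show ?thesis unfolding D_def by (simp add: scaleR_diff_right mult_ac)
    qed
    \<comment> \<open>Leibniz's rule takes the derivative as a bounded linear function; its
      continuity is then reduced to that of the directional derivatives by
      \<open>Dexp\<close>.\<close>
    have bl: "blinfun_apply (Blinfun (D y t)) = D y t" if "y \<in> V" "t \<in> {0..1}" for y t
      using Dd[OF that] by (intro bounded_linear_Blinfun_apply has_derivative_bounded_linear)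
    have ch: "continuous_on V h" using Suc.prems(2) by (rule Ck_on_continuous)
    have cD: "continuous_on V (\<lambda>z. frechet_derivative h (at z) v)" for v
      using Suc.prems(2) by (intro Ck_on_continuous[of k]) simp
    have c\<phi>: "continuous_on {0..1} (\<lambda>t. \<phi> t * (1 - t))" using Suc.prems(1) by (intro continuous_intros)
    have cB: "continuous_on (V \<times> cbox 0 1) (\<lambda>(y, t). Blinfun (D y t))"
    proof (rule continuous_on_blinfun_componentwise)
      fix i :: 'a
      have "continuous_on (V \<times> cbox 0 1) (\<lambda>x. (\<lambda>(y, t). \<phi> t *\<^sub>R frechet_derivative h (at (?s t y)) i) x
        - (i \<bullet> e) *\<^sub>R (\<lambda>(y, t). (\<phi> t * (1 - t)) *\<^sub>R frechet_derivative h (at (?s t y)) e) x)"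
        by (intro continuous_on_diff continuous_on_scaleR continuous_on_const cont[OF Suc.prems(1) cD] cont[OF c\<phi> cD])
      then show "continuous_on (V \<times> cbox 0 1) (\<lambda>x. blinfun_apply ((\<lambda>(y, t). Blinfun (D y t)) x) i)"
        by (rule continuous_on_eq) (auto simp: bl Dexp)
    qed
    have integrable: "(\<lambda>t. \<psi> t *\<^sub>R g (?s t y)) integrable_on {0..1}"
      if "continuous_on {0..1} \<psi>" "continuous_on V g" "y \<in> V" for \<psi> y and g :: "'a \<Rightarrow> 'b"
    proof -
      have "continuous_on {0..1} ((\<lambda>(y, t). \<psi> t *\<^sub>R g (?s t y)) \<circ> (\<lambda>t. (y, t)))"
        using that(3) by (intro continuous_on_compose continuous_on_subset[OF cont[OF that(1,2)]] continuous_intros) auto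
      then show ?thesis by (simp add: integrable_continuous_real o_def)
    qed
    have deriv: "((\<lambda>y. integral {0..1} (\<lambda>t. \<phi> t *\<^sub>R h (?s t y))) has_derivative
        blinfun_apply (integral {0..1} (\<lambda>t. Blinfun (D y t)))) (at y)" if "y \<in> V" for y
    proof -
      have "((\<lambda>y. integral (cbox 0 1) (\<lambda>t. \<phi> t *\<^sub>R h (?s t y))) has_derivative
        blinfun_apply (integral (cbox 0 1) (\<lambda>t. Blinfun (D y t)))) (at y within V)"
      proof (rule leibniz_rule[OF _ _ cB that V(2)])
        show "((\<lambda>y. \<phi> t *\<^sub>R h (?s t y)) has_derivative blinfun_apply (Blinfun (D y t))) (at y within V)"
          if "y \<in> V" "t \<in> cbox 0 1" for y t
          using Dd[of y t] bl[of y t] that by (simp add: has_derivative_at_withinI)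
        show "(\<lambda>t. \<phi> t *\<^sub>R h (?s t y)) integrable_on cbox 0 1" if "y \<in> V" for y
          using integrable[OF Suc.prems(1) ch that] by simp
      qed
      then show ?thesis unfolding at_within_open[OF that V(1)] box_real .
    qed
    show ?case
    proof (rule Ck_on_SucI[OF V(1) deriv])
      fix v
      let ?G = "\<lambda>y. integral {0..1} (\<lambda>t. \<phi> t *\<^sub>R frechet_derivative h (at (?s t y)) v)
          - (v \<bullet> e) *\<^sub>R integral {0..1} (\<lambda>t. (\<phi> t * (1 - t)) *\<^sub>R frechet_derivative h (at (?s t y)) e)"
      have "Ck_on k V (\<lambda>y. integral {0..1} (\<lambda>t. \<phi> t *\<^sub>R frechet_derivative h (at (?s t y)) v)
          + - (v \<bullet> e) *\<^sub>R integral {0..1} (\<lambda>t. (\<phi> t * (1 - t)) *\<^sub>R frechet_derivative h (at (?s t y)) e))"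
        using Suc.prems(2)
        by (intro Ck_on_add[OF V(1)] Ck_on_bounded_linear_compose[OF V(1) bounded_linear_scaleR_right]
            Suc.IH[OF Suc.prems(1)] Suc.IH[OF c\<phi>]) simp_all
      then have "Ck_on k V ?G" by simp
      moreover have "?G y = blinfun_apply (integral {0..1} (\<lambda>t. Blinfun (D y t))) v" if "y \<in> V" for y
      proof -
        have "continuous_on {0..1} ((\<lambda>(y, t). Blinfun (D y t)) \<circ> (\<lambda>t. (y, t)))"
          using that by (intro continuous_on_compose continuous_on_subset[OF cB] continuous_intros) auto
        then have "(\<lambda>t. Blinfun (D y t)) integrable_on {0..1}"
          by (simp add: integrable_continuous_real o_def)
        then have "blinfun_apply (integral {0..1} (\<lambda>t. Blinfun (D y t))) v = integral {0..1} (\<lambda>t. D y t v)"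
          using that by (subst blinfun_apply_integral) (auto intro!: integral_cong simp: bl)
        also have "\<dots> = integral {0..1} (\<lambda>t. \<phi> t *\<^sub>R frechet_derivative h (at (?s t y)) v
            - (v \<bullet> e) *\<^sub>R ((\<phi> t * (1 - t)) *\<^sub>R frechet_derivative h (at (?s t y)) e))"
          using that by (intro integral_cong Dexp)
        also have "\<dots> = integral {0..1} (\<lambda>t. \<phi> t *\<^sub>R frechet_derivative h (at (?s t y)) v)
            - integral {0..1} (\<lambda>t. (v \<bullet> e) *\<^sub>R ((\<phi> t * (1 - t)) *\<^sub>R frechet_derivative h (at (?s t y)) e))"
          by (rule integral_diff[OF integrable[OF Suc.prems(1) cD that] integrable_cmul[OF integrable[OF c\<phi> cD that]]])
        also have "\<dots> = ?G y"
          by (simp only: integral_cmul)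
        finally show ?thesis by (rule sym)
      qed
      ultimately show "Ck_on k V (\<lambda>y. blinfun_apply (integral {0..1} (\<lambda>t. Blinfun (D y t))) v)"
        by (rule Ck_on_cong[OF V(1), rotated])
    qed
  }
qed

text \<open>The fundamental theorem of calculus on the segment from the projection of
  \<open>y\<close> to the hyperplane orthogonal to \<open>e\<close>, where \<open>h\<close>
  vanishes, to \<open>y\<close> itself. The chain rule produces the factor
  \<open>y \<bullet> e\<close>, and the remaining integral is \<open>K\<close>.\<close>

lemma smooth_divide_coordinate:
  fixes h :: "'a::euclidean_space \<Rightarrow> 'b::euclidean_space" and e :: 'a
  assumes V: "open V" "convex V" "\<And>y t. y \<in> V \<Longrightarrow> t \<in> {0..1} \<Longrightarrow> y - ((1 - t) * (y \<bullet> e)) *\<^sub>R e \<in> V"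
    and e: "e \<bullet> e = 1" and h: "smooth_on V h" and h0: "\<And>y. y \<in> V \<Longrightarrow> y \<bullet> e = 0 \<Longrightarrow> h y = 0"
  obtains K where "smooth_on V K" "\<And>y. y \<in> V \<Longrightarrow> h y = (y \<bullet> e) *\<^sub>R K y"
proof
  let ?s = "\<lambda>t y. y - ((1 - t) * (y \<bullet> e)) *\<^sub>R e"
  let ?K = "\<lambda>y. integral {0..1} (\<lambda>t. (1::real) *\<^sub>R frechet_derivative h (at (?s t y)) e)"
  show "smooth_on V ?K"
    using h V smooth_on_derivative[OF h, of e] unfolding smooth_on_def
    by (intro allI Ck_on_integral_shrink) auto
  show "h y = (y \<bullet> e) *\<^sub>R ?K y" if y: "y \<in> V" for y
  proof -
    have "((\<lambda>t. (y \<bullet> e) *\<^sub>R frechet_derivative h (at (?s t y)) e) has_integral h (?s 1 y) - h (?s 0 y)) {0..1}"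
    proof (rule fundamental_theorem_of_calculus)
      fix t :: real assume t: "t \<in> {0..1}"
      have D: "(h has_derivative frechet_derivative h (at (?s t y))) (at (?s t y))"
        using smooth_on_has_derivative[OF h V(1) V(3)[OF y t]] .
      have "((\<lambda>t. ?s t y) has_derivative (\<lambda>u. (u * (y \<bullet> e)) *\<^sub>R e)) (at t within {0..1})"
        by (auto intro!: derivative_eq_intros)
      from has_derivative_compose[OF this D]
      have "((\<lambda>t. h (?s t y)) has_derivative (\<lambda>u. frechet_derivative h (at (?s t y)) ((u * (y \<bullet> e)) *\<^sub>R e))) (at t within {0..1})" .
      then show "((\<lambda>t. h (?s t y)) has_vector_derivative (y \<bullet> e) *\<^sub>R frechet_derivative h (at (?s t y)) e) (at t within {0..1})"
        by (simp add: has_vector_derivative_def linear_scale[OF has_derivative_linear[OF D]])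
    qed simp
    moreover have "h (?s 0 y) = 0"
      using V(3)[OF y, of 0] by (intro h0) (auto simp: inner_diff_left e)
    ultimately show ?thesis
      by (simp add: integral_unique flip: integral_cmul)
  qed
qed

text \<open>
  Hadamard's lemma. In the coordinates \<open>\<Phi> z = z + (\<rho> z - z \<bullet> e) e\<close> the function \<open>\<rho>\<close> becomes
  \<open>y \<bullet> e\<close>; smoothness of the inverse is bootstrapped from the formula for its derivative.
\<close>

lemma smooth_division:
  fixes \<rho> :: "'a::euclidean_space \<Rightarrow> real" and G :: "'a \<Rightarrow> 'b::euclidean_space"
  assumes W: "open W" "p \<in> W" and \<rho>: "smooth_on W \<rho>" and G: "smooth_on W G"
    and \<rho>p: "\<rho> p = 0" "frechet_derivative \<rho> (at p) w \<noteq> 0" and G0: "\<And>z. z \<in> W \<Longrightarrow> \<rho> z = 0 \<Longrightarrow> G z = 0"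
  obtains W' A where "open W'" "p \<in> W'" "smooth_on W' A" "\<And>z. z \<in> W' \<Longrightarrow> G z = \<rho> z *\<^sub>R A z"
proof -
  define e where "e = w /\<^sub>R norm w"
  let ?d = "\<lambda>z. frechet_derivative \<rho> (at z)"
  have D: "(\<rho> has_derivative ?d z) (at z)" if "z \<in> W" for z
    using smooth_on_has_derivative[OF \<rho> W(1) that] .
  have lin: "linear (?d z)" if "z \<in> W" for z using D[OF that] by (rule has_derivative_linear)
  have "w \<noteq> 0" using \<rho>p(2) linear_0[OF lin[OF W(2)]] by auto
  then have e: "e \<bullet> e = 1" and dpe: "?d p e \<noteq> 0"
    using \<rho>p(2) by (auto simp: e_def linear_scale[OF lin[OF W(2)]] dot_square_norm power2_eq_square)
  define W0 where "W0 = {z \<in> W. ?d z e \<noteq> 0}"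
  have cd: "continuous_on W (\<lambda>z. ?d z v)" for v
    using smooth_on_derivative[OF \<rho>] by (rule smooth_on_continuous)
  have W0: "open W0" "p \<in> W0" "W0 \<subseteq> W"
    using continuous_open_preimage[OF cd W(1), of "- {0}" e] W(2) dpe
    by (auto simp: W0_def vimage_def Int_def)
  define \<Phi> where "\<Phi> z = z + (\<rho> z - z \<bullet> e) *\<^sub>R e" for z
  define d\<Phi> where "d\<Phi> z v = v + (?d z v - v \<bullet> e) *\<^sub>R e" for z v
  \<comment> \<open>\<open>d\<Phi> z\<close> changes a vector by a multiple of \<open>e\<close> and
    sends \<open>e\<close> to \<open>?d z e *\<^sub>R e\<close>. Its inverse therefore also
    subtracts a multiple of \<open>e\<close>, with divisor \<open>?d z e\<close>, nonzero on
    \<open>W0\<close>.\<close>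
  define i\<Phi> where "i\<Phi> z v = v - ((?d z v - v \<bullet> e) * inverse (?d z e)) *\<^sub>R e" for z v
  have \<Phi>: "(\<Phi> has_derivative d\<Phi> z) (at z)" if "z \<in> W0" for z
    unfolding \<Phi>_def d\<Phi>_def using D[of z] that W0(3) by (auto intro!: derivative_eq_intros)
  have bl: "blinfun_apply (Blinfun (d\<Phi> z)) = d\<Phi> z" if "z \<in> W0" for z
    using \<Phi>[OF that] by (intro bounded_linear_Blinfun_apply has_derivative_bounded_linear)
  have d\<Phi>_i\<Phi>: "d\<Phi> z (i\<Phi> z v) = v" and i\<Phi>_d\<Phi>: "i\<Phi> z (d\<Phi> z v) = v" if "z \<in> W0" for z v
  proof -
    interpret linear "?d z" using lin that W0(3) by blast
    have "?d z e \<noteq> 0" using that by (simp add: W0_def)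
    define c where "c = (?d z v - v \<bullet> e) * inverse (?d z e)"
    have "c * ?d z e = ?d z v - v \<bullet> e" using \<open>?d z e \<noteq> 0\<close> by (simp add: c_def)
    then have "?d z (v - c *\<^sub>R e) - (v - c *\<^sub>R e) \<bullet> e = c" by (simp add: diff scale inner_diff_left e)
    then show "d\<Phi> z (i\<Phi> z v) = v" unfolding i\<Phi>_def c_def[symmetric] d\<Phi>_def by simp
    define m where "m = ?d z v - v \<bullet> e"
    have "?d z (v + m *\<^sub>R e) - (v + m *\<^sub>R e) \<bullet> e = m * ?d z e"
      by (simp add: add scale inner_add_left e m_def)
    then show "i\<Phi> z (d\<Phi> z v) = v"
      unfolding d\<Phi>_def m_def[symmetric] i\<Phi>_def using \<open>?d z e \<noteq> 0\<close> by simp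
  qed
  have "bounded_linear (?d p)" using D[OF W(2)] by (rule has_derivative_bounded_linear)
  then have "bounded_linear (i\<Phi> p)"
    unfolding i\<Phi>_def
    by (intro bounded_linear_sub bounded_linear_ident bounded_linear_scaleR_const bounded_linear_mult_const
      bounded_linear_inner_left)
  \<comment> \<open>A left inverse of the derivative at \<open>p\<close> is what the inverse
    function theorem asks for; at other points \<open>i\<Phi>\<close> serves to identify the
    derivative of \<open>g\<close>.\<close>
  then have "Blinfun (i\<Phi> p) o\<^sub>L Blinfun (d\<Phi> p) = id_blinfun"
    by (intro blinfun_eqI) (simp add: bounded_linear_Blinfun_apply bl W0(2) i\<Phi>_d\<Phi>)
  moreover have "continuous_on W0 (\<lambda>z. Blinfun (d\<Phi> z))"
  proof (rule continuous_on_blinfun_componentwise)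
    fix i :: 'a
    have "continuous_on W0 (\<lambda>z. d\<Phi> z i)"
      unfolding d\<Phi>_def by (intro continuous_intros continuous_on_subset[OF cd W0(3)])
    then show "continuous_on W0 (\<lambda>z. blinfun_apply (Blinfun (d\<Phi> z)) i)"
      by (rule continuous_on_eq) (simp add: bl)
  qed
  moreover have "(\<Phi> has_derivative blinfun_apply (Blinfun (d\<Phi> z))) (at z)" if "z \<in> W0" for z
    using \<Phi>[OF that] bl[OF that] by simp
  ultimately obtain U' V' g g' where U': "open U'" "U' \<subseteq> W0" "p \<in> U'" and V': "open V'" "\<Phi> p \<in> V'"
    and hom: "homeomorphism U' V' \<Phi> g"
    and g: "\<And>y. y \<in> V' \<Longrightarrow> (g has_derivative g' y) (at y)"
    and g': "\<And>y. y \<in> V' \<Longrightarrow> g' y = inv (blinfun_apply (Blinfun (d\<Phi> (g y))))"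
    using inverse_function_theorem[OF W0(1) _ _ W0(2), of \<Phi> "\<lambda>z. Blinfun (d\<Phi> z)" "Blinfun (i\<Phi> p)"] by metis
  have gU: "g y \<in> U'" "\<Phi> (g y) = y" if "y \<in> V'" for y
    using hom that by (auto simp: homeomorphism_def)
  have gW: "g y \<in> W0" "g y \<in> W" if "y \<in> V'" for y using gU(1)[OF that] U'(2) W0(3) by auto
  have g'_eq: "g' y = i\<Phi> (g y)" if "y \<in> V'" for y
    unfolding g'[OF that] bl[OF gW(1)[OF that]]
    by (intro inv_unique_comp) (simp_all add: fun_eq_iff d\<Phi>_i\<Phi> i\<Phi>_d\<Phi> gW that)
  have "Ck_on k V' g" for k
  proof (induction k)
    case 0
    then show ?case using hom by (simp add: homeomorphism_def)
  next
    case (Suc k)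
    show ?case
    proof (rule Ck_on_SucI[OF V'(1) g])
      fix v
      have d: "Ck_on k V' (\<lambda>y. ?d (g y) v)" for v
        using Ck_on_compose[OF V'(1) W(1) gW(2) _ Suc] smooth_on_derivative[OF \<rho>]
        unfolding smooth_on_def by blast
      have inv: "Ck_on k V' (\<lambda>y. inverse (?d (g y) e))"
        using gW by (intro Ck_on_inverse[OF V'(1) d]) (auto simp: W0_def)
      have "Ck_on k V' (\<lambda>y. (?d (g y) v + - (v \<bullet> e)) * inverse (?d (g y) e))"
        by (intro bounded_bilinear.Ck_on[OF bounded_bilinear_mult V'(1)] inv Ck_on_add[OF V'(1)] d Ck_on_const)
      then have "Ck_on k V' (\<lambda>y. v + ((?d (g y) v + - (v \<bullet> e)) * inverse (?d (g y) e)) *\<^sub>R (- e))"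
        by (intro Ck_on_add[OF V'(1)] Ck_on_const Ck_on_bounded_linear_compose[OF V'(1) bounded_linear_scaleR_left])
      then have "Ck_on k V' (\<lambda>y. i\<Phi> (g y) v)" by (simp add: i\<Phi>_def)
      then show "Ck_on k V' (\<lambda>y. g' y v)"
        by (rule Ck_on_cong[OF V'(1), rotated]) (simp add: g'_eq)
    qed
  qed
  then have smooth_g: "smooth_on V' g" by (simp add: smooth_on_def)
  have \<Phi>e: "\<Phi> z \<bullet> e = \<rho> z" for z by (simp add: \<Phi>_def inner_add_left e)
  obtain r where r: "0 < r" "ball (\<Phi> p) r \<subseteq> V'" using V' open_contains_ball by blast
  let ?B = "ball (\<Phi> p) r"
  \<comment> \<open>The centre \<open>\<Phi> p\<close> lies on the hyperplane orthogonal to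
    \<open>e\<close>, so shrinking the coordinate along \<open>e\<close> does not increase the
    distance to it.\<close>
  have "y - ((1 - t) * (y \<bullet> e)) *\<^sub>R e \<in> ?B" if "y \<in> ?B" "t \<in> {0..1}" for y t
  proof -
    have "\<Phi> p \<bullet> e = 0" by (simp add: \<Phi>e \<rho>p)
    then have ye: "(y - \<Phi> p) \<bullet> e = y \<bullet> e" by (simp add: inner_diff_left)
    have "(norm (y - \<Phi> p - ((1 - t) * (y \<bullet> e)) *\<^sub>R e))\<^sup>2 = (norm (y - \<Phi> p))\<^sup>2 - (1 - t\<^sup>2) * (y \<bullet> e)\<^sup>2"
    proof -
      have "(u - c *\<^sub>R e) \<bullet> (u - c *\<^sub>R e) = u \<bullet> u - 2 * c * (u \<bullet> e) + c * c" for u :: 'a and c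
        using e by (simp add: inner_diff_left inner_diff_right inner_commute[of e u] algebra_simps)
      from this[of "y - \<Phi> p" "(1 - t) * (y \<bullet> e)"] show ?thesis
        unfolding power2_norm_eq_inner ye by (simp only:) (simp add: power2_eq_square left_diff_distrib right_diff_distrib mult_ac)
    qed
    also have "\<dots> \<le> (norm (y - \<Phi> p))\<^sup>2"
      using that(2) by (simp add: power_le_one)
    finally have "norm (y - \<Phi> p - ((1 - t) * (y \<bullet> e)) *\<^sub>R e) \<le> norm (y - \<Phi> p)"
      by (rule power2_le_imp_le) simp
    then have "dist (y - ((1 - t) * (y \<bullet> e)) *\<^sub>R e) (\<Phi> p) \<le> dist y (\<Phi> p)"
      by (simp add: dist_norm algebra_simps)
    then show ?thesis using that(1) by (simp add: dist_commute)
  qed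
  moreover have "smooth_on ?B (\<lambda>y. G (g y))"
    using smooth_on_compose[OF V'(1) W(1) gW(2) G smooth_g] r(2) by (rule smooth_on_subset)
  moreover have "G (g y) = 0" if "y \<in> ?B" "y \<bullet> e = 0" for y
    using that r(2) gU(2)[of y] gW(2)[of y] \<Phi>e[of "g y"] by (intro G0) auto
  ultimately obtain K where K: "smooth_on ?B K" "\<And>y. y \<in> ?B \<Longrightarrow> G (g y) = (y \<bullet> e) *\<^sub>R K y"
    using smooth_divide_coordinate[of ?B e "\<lambda>y. G (g y)"] e by (metis open_ball convex_ball)
  have smooth_\<Phi>: "smooth_on W \<Phi>"
    unfolding \<Phi>_def
    by (intro smooth_on_add smooth_on_ident smooth_on_scaleR smooth_on_diff \<rho> smooth_on_const W(1)
      smooth_on_bounded_linear[OF W(1) bounded_linear_inner_left])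
  define W' where "W' = U' \<inter> \<Phi> -` ?B"
  have "open W'"
    unfolding W'_def using U' W0 smooth_\<Phi>
    by (intro continuous_open_preimage[of U'] continuous_on_subset[OF smooth_on_continuous[OF smooth_\<Phi>]]) auto
  moreover have "p \<in> W'" using U'(3) r(1) by (simp add: W'_def)
  moreover have "smooth_on W' (\<lambda>z. K (\<Phi> z))"
    using \<open>open W'\<close> U' W0 by (intro smooth_on_compose[OF _ open_ball _ K(1)] smooth_on_subset[OF smooth_\<Phi>]) (auto simp: W'_def)
  moreover have "G z = \<rho> z *\<^sub>R K (\<Phi> z)" if "z \<in> W'" for z
  proof -
    have "g (\<Phi> z) = z" using that hom by (auto simp: W'_def homeomorphism_def)
    then show ?thesis using K(2)[of "\<Phi> z"] that by (simp add: W'_def \<Phi>e)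
  qed
  ultimately show thesis by (rule that)
qed

section \<open>Functions on a hypersurface\<close>

text \<open>
  A tangent vector \<open>v\<close> is a limit of secant directions of the level set: \<open>\<rho>\<close> changes sign between
  \<open>p + t (v - s g)\<close> and \<open>p + t (v + s g)\<close> for small \<open>t\<close>.
\<close>

lemma level_set_secant:
  fixes \<rho> :: "'a::euclidean_space \<Rightarrow> real"
  assumes U: "open U" "p \<in> U" "continuous_on U \<rho>" and D: "(\<rho> has_derivative D) (at p)"
    and \<rho>p: "\<rho> p = 0" and v: "D v = 0" and g: "D g > 0" and "0 < s" "0 < \<delta>"
  obtains t c where "0 < t" "t < \<delta>" "\<bar>c\<bar> \<le> s" "p + t *\<^sub>R (v + c *\<^sub>R g) \<in> U" "\<rho> (p + t *\<^sub>R (v + c *\<^sub>R g)) = 0"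
proof -
  interpret D: bounded_linear D using D by (rule has_derivative_bounded_linear)
  obtain r where r: "0 < r" "ball p r \<subseteq> U" using U open_contains_ball by blast
  have ray: "((\<lambda>t. \<rho> (p + t *\<^sub>R w)) has_real_derivative D w) (at 0)" for w
  proof -
    have "((\<lambda>t. p + t *\<^sub>R w) has_derivative (\<lambda>t. t *\<^sub>R w)) (at 0)"
      by (auto intro!: derivative_eq_intros)
    moreover have "(\<rho> has_derivative D) (at (p + 0 *\<^sub>R w))" using D by simp
    ultimately have "((\<lambda>t. \<rho> (p + t *\<^sub>R w)) has_derivative (\<lambda>t. D (t *\<^sub>R w))) (at 0)"
      by (rule has_derivative_compose)
    then show ?thesis by (simp add: has_field_derivative_def D.scaleR mult.commute[of _ "D w"])
  qed
  have "D (v + s *\<^sub>R g) > 0" "D (v + (- s) *\<^sub>R g) < 0"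
    using v g \<open>0 < s\<close> by (simp_all add: D.add D.scaleR D.diff D.neg)
  from DERIV_pos_inc_right[OF ray this(1)] DERIV_neg_dec_right[OF ray this(2)]
  obtain d1 d2 where d1: "0 < d1" "\<And>t. 0 < t \<Longrightarrow> t < d1 \<Longrightarrow> 0 < \<rho> (p + t *\<^sub>R (v + s *\<^sub>R g))"
    and d2: "0 < d2" "\<And>t. 0 < t \<Longrightarrow> t < d2 \<Longrightarrow> \<rho> (p + t *\<^sub>R (v + (- s) *\<^sub>R g)) < 0"
    using \<rho>p by auto
  \<comment> \<open>Bounds the norm of \<open>v + c *\<^sub>R g\<close> for \<bar>c\<bar> \<le> s;
    the summand 1 makes it positive, so that \<open>r / M\<close> can bound
    \<open>t\<close>.\<close>
  define M where "M = norm v + s * norm g + 1"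
  have M: "0 < M" using \<open>0 < s\<close> by (simp add: M_def add_nonneg_pos)
  define m where "m = min (min d1 d2) (min \<delta> (r / M))"
  define t where "t = m / 2"
  have m: "0 < m" "m \<le> d1" "m \<le> d2" "m \<le> \<delta>" "m \<le> r / M"
    using d1(1) d2(1) \<open>0 < \<delta>\<close> r(1) M by (auto simp: m_def)
  have "t < r / M" unfolding t_def using m(1,5) by linarith
  then have t: "0 < t" "t < d1" "t < d2" "t < \<delta>" "t * M < r"
    using m M by (auto simp: t_def pos_less_divide_eq)
  have inU: "p + t *\<^sub>R (v + c *\<^sub>R g) \<in> U" if "\<bar>c\<bar> \<le> s" for c
  proof -
    have "norm (v + c *\<^sub>R g) \<le> norm v + \<bar>c\<bar> * norm g" using norm_triangle_ineq[of v "c *\<^sub>R g"] by simp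
    also have "\<dots> \<le> M" using mult_right_mono[OF that, of "norm g"] by (simp add: M_def)
    finally have "t * norm (v + c *\<^sub>R g) \<le> t * M" using t(1) by simp
    then have "t * norm (v + c *\<^sub>R g) < r" using t(5) by linarith
    then show ?thesis using t(1) by (intro subsetD[OF r(2)]) (simp add: dist_norm)
  qed
  have "continuous_on {- s..s} (\<lambda>c. \<rho> (p + t *\<^sub>R (v + c *\<^sub>R g)))"
    by (rule continuous_on_compose2[OF U(3)]) (auto intro!: continuous_intros inU)
  with d1(2)[of t] d2(2)[of t] t \<open>0 < s\<close> have "\<exists>c. - s \<le> c \<and> c \<le> s \<and> \<rho> (p + t *\<^sub>R (v + c *\<^sub>R g)) = 0"
    by (intro IVT') auto
  then show thesis using that[of t] t inU by (metis abs_le_iff minus_le_iff)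
qed

text \<open>The difference \<open>C\<close> of the two maps is a derivative of the zero function
  along the level set, hence small on secant vectors. By \<open>level_set_secant\<close> these have
  directions \<open>v + c *\<^sub>R g'\<close> with \<open>c\<close> arbitrarily small, which forces
  \<open>C v = 0\<close>.\<close>

lemma level_set_derivative_unique:
  fixes \<rho> :: "'a::euclidean_space \<Rightarrow> real" and f :: "'a \<Rightarrow> 'b::real_normed_vector"
  assumes U: "open U" "p \<in> U" "continuous_on U \<rho>" and D: "(\<rho> has_derivative D) (at p)"
    and \<rho>p: "\<rho> p = 0" and v: "D v = 0" and g: "D g \<noteq> 0"
    and A: "(f has_derivative A) (at p within {z \<in> U. \<rho> z = 0})"
    and B: "(f has_derivative B) (at p within {z \<in> U. \<rho> z = 0})"
  shows "A v = B v"
proof -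
  define C where "C w = A w - B w" for w
  have C: "((\<lambda>z. 0) has_derivative C) (at p within {z \<in> U. \<rho> z = 0})"
    using has_derivative_diff[OF A B] by (simp add: C_def[abs_def])
  interpret C: bounded_linear C using C by (rule has_derivative_bounded_linear)
  interpret D: bounded_linear D using D by (rule has_derivative_bounded_linear)
  obtain g' where g': "D g' > 0"
    using g D.neg[of g] by (metis neg_0_less_iff_less linorder_neqE_linordered_idom)
  have bound: "norm (C v) \<le> s * (norm v + norm g' + norm (C g'))" if "0 < s" "s < 1" for s
  proof -
    \<comment> \<open>The same \<open>s\<close> bounds the error of the derivative and the deviation
      of the secant from \<open>v\<close>, so both errors vanish together.\<close>
    obtain d where d: "0 < d" "\<And>z. z \<in> U \<Longrightarrow> \<rho> z = 0 \<Longrightarrow> norm (z - p) < d \<Longrightarrow> norm (C (z - p)) \<le> s * norm (z - p)"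
      using C \<open>0 < s\<close> unfolding has_derivative_within_alt by fastforce
    define M where "M = norm v + norm g' + 1"
    have M: "0 < M" by (simp add: M_def add_nonneg_pos)
    obtain t c where t: "0 < t" "t < d / M" and c: "\<bar>c\<bar> \<le> s"
      and z: "p + t *\<^sub>R (v + c *\<^sub>R g') \<in> U" "\<rho> (p + t *\<^sub>R (v + c *\<^sub>R g')) = 0"
      using level_set_secant[OF U D \<rho>p v g' \<open>0 < s\<close>, of "d / M"] d(1) M by auto
    let ?w = "v + c *\<^sub>R g'"
    have nw: "norm ?w \<le> norm v + norm g'"
      using norm_triangle_ineq[of v "c *\<^sub>R g'"] mult_right_mono[of "\<bar>c\<bar>" 1 "norm g'"] c that by simp
    then have "t * norm ?w \<le> t * M" using t(1) by (simp add: M_def)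
    also have "\<dots> < d" using t(2) M by (simp add: field_simps)
    finally have "norm (C (t *\<^sub>R ?w)) \<le> s * norm (t *\<^sub>R ?w)" using d(2)[OF z] t(1) by simp
    then have "norm (C ?w) \<le> s * norm ?w" using t(1) by (simp add: C.scaleR)
    also have "\<dots> \<le> s * (norm v + norm g')" using nw that by simp
    finally have "norm (C ?w) \<le> s * (norm v + norm g')" .
    moreover have "norm (C v) \<le> norm (C ?w) + norm (c *\<^sub>R C g')"
      using norm_triangle_ineq4[of "C ?w" "c *\<^sub>R C g'"] by (simp add: C.add C.scaleR)
    moreover have "norm (c *\<^sub>R C g') \<le> s * norm (C g')" using c by (simp add: mult_right_mono)
    ultimately show ?thesis by (simp add: distrib_left)
  qed
  have "norm (C v) \<le> 0"
  proof (rule tendsto_lowerbound)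
    show "((\<lambda>s. s * (norm v + norm g' + norm (C g'))) \<longlongrightarrow> 0) (at_right 0)"
      by (auto intro!: tendsto_eq_intros)
    show "\<forall>\<^sub>F s in at_right 0. norm (C v) \<le> s * (norm v + norm g' + norm (C g'))"
      using bound by (intro eventually_at_rightI[of 0 1]) auto
  qed simp
  then show ?thesis by (simp add: C_def)
qed

lemma gradient_inner:
  assumes "(\<rho> has_derivative frechet_derivative \<rho> (at p)) (at p)"
  shows "frechet_derivative \<rho> (at p) v = v \<bullet> gradient \<rho> p"
proof -
  interpret bounded_linear "frechet_derivative \<rho> (at p)"
    using assms by (rule has_derivative_bounded_linear)
  have "frechet_derivative \<rho> (at p) v = frechet_derivative \<rho> (at p) (\<Sum>b\<in>Basis. (v \<bullet> b) *\<^sub>R b)"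
    by (simp add: euclidean_representation)
  also have "\<dots> = v \<bullet> gradient \<rho> p"
    by (simp add: sum scaleR gradient_def inner_sum_right mult.commute)
  finally show ?thesis .
qed

text \<open>The part of \<open>n\<close> orthogonal to \<open>g\<close> is a tangent vector, so
  \<open>n\<close> is orthogonal to it; being orthogonal to \<open>g\<close> as well, it is
  orthogonal to itself.\<close>

lemma unit_normal_gradient:
  assumes "\<And>v. v \<bullet> g = 0 \<Longrightarrow> n \<bullet> v = 0" and "norm n = 1" and "g \<noteq> 0"
  obtains c where "c \<noteq> 0" "n = c *\<^sub>R g"
proof -
  define c where "c = (n \<bullet> g) / (g \<bullet> g)"
  have 1: "(n - c *\<^sub>R g) \<bullet> g = 0" using assms(3) by (simp add: c_def inner_diff_left)
  then have "n \<bullet> (n - c *\<^sub>R g) = 0" by (rule assms(1))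
  then have "(n - c *\<^sub>R g) \<bullet> (n - c *\<^sub>R g) = 0"
    using 1 by (simp add: inner_diff_left inner_diff_right inner_commute)
  then have "n = c *\<^sub>R g" by simp
  then show thesis using that assms(2) by (metis norm_zero scaleR_zero_left zero_neq_one)
qed

lemma dbar_dirac: "dbar F z = dirac (frechet_derivative F (at z))"
  by (simp add: dbar_def dirac_def)

text \<open>The units that \<open>dbar\<close> attaches to the partial derivatives are the
  orthonormal basis vectors in \<open>gradient\<close>. The real gradient, read as a pair of
  quaternions, is thus the vector in the CRF condition.\<close>

lemma dbar_of_real:
  assumes "(\<rho> has_derivative frechet_derivative \<rho> (at p)) (at p)"
  shows "dbar (\<lambda>w. of_real (\<rho> w)) p = gradient \<rho> p"
proof -
  have "((\<lambda>w. of_real (\<rho> w) :: quat) has_derivative (\<lambda>v. of_real (frechet_derivative \<rho> (at p) v))) (at p)"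
    using bounded_linear.has_derivative[OF bounded_linear_of_real assms] .
  then have "frechet_derivative (\<lambda>w. of_real (\<rho> w) :: quat) (at p) = (\<lambda>v. of_real (v \<bullet> gradient \<rho> p))"
    using gradient_inner[OF assms] by (simp add: frechet_derivative_at[symmetric])
  then show ?thesis
    using sum_iunit_inner(1,2)[of "gradient \<rho> p"]
    by (simp add: dbar_def prod_eq_iff of_real_def)
qed

lemma smooth_on_dbar:
  assumes "open V" "smooth_on V F"
  shows "smooth_on V (dbar F)"
  unfolding dbar_def[abs_def]
  by (intro smooth_on_Pair smooth_on_sum smooth_on_mult smooth_on_const smooth_on_derivative assms)

section \<open>The CRF condition on an oriented hypersurface\<close>

locale oriented_hypersurface =
  fixes U S :: "qpoint set" and \<rho> :: "qpoint \<Rightarrow> real" and \<nu> :: "qpoint \<Rightarrow> qpoint"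
  assumes hypersurface: "defining_function U \<rho> S" and orientation: "unit_normal_field \<rho> S \<nu>"
begin

lemma U: "open U" "smooth_on U \<rho>" and S: "S = {z \<in> U. \<rho> z = 0}" and gradient: "p \<in> S \<Longrightarrow> gradient \<rho> p \<noteq> 0"
  using hypersurface unfolding defining_function_def by blast+

lemma D\<rho>: "p \<in> U \<Longrightarrow> (\<rho> has_derivative frechet_derivative \<rho> (at p)) (at p)"
  using smooth_on_has_derivative[OF U(2,1)] .

lemma normal:
  assumes "p \<in> S"
  shows "tangent_space \<rho> p = {v. v \<bullet> \<nu> p = 0}" "\<nu> p \<bullet> \<nu> p = 1" "\<exists>c. c \<noteq> 0 \<and> \<nu> p = c *\<^sub>R gradient \<rho> p"
proof -
  have "p \<in> U" using assms S by blast
  note D = gradient_inner[OF D\<rho>[OF this]]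
  have n: "norm (\<nu> p) = 1" "\<And>v. v \<in> tangent_space \<rho> p \<Longrightarrow> \<nu> p \<bullet> v = 0"
    using orientation assms unfolding unit_normal_field_def by blast+
  then show "\<nu> p \<bullet> \<nu> p = 1" by (simp add: norm_eq_1)
  obtain c where c: "c \<noteq> 0" "\<nu> p = c *\<^sub>R gradient \<rho> p"
    using unit_normal_gradient[OF _ n(1) gradient[OF assms]] n(2) by (auto simp: tangent_space_def D)
  then show "\<exists>c. c \<noteq> 0 \<and> \<nu> p = c *\<^sub>R gradient \<rho> p" by blast
  show "tangent_space \<rho> p = {v. v \<bullet> \<nu> p = 0}" using c by (auto simp: tangent_space_def D)
qed

text \<open>The derivative of \<open>F\<close> is also a derivative of \<open>f\<close> along
  \<open>S\<close>, so by uniqueness on tangent vectors it agrees there with the one chosen in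
  \<open>surface_diff\<close>.\<close>

lemma surface_point_extension:
  assumes "p \<in> S" "open W" "p \<in> W" "smooth_on W F" "\<And>z. z \<in> S \<inter> W \<Longrightarrow> F z = f z"
  shows "surface_point \<rho> S \<nu> f p (frechet_derivative F (at p))"
proof (rule surface_point.intro)
  have pU: "p \<in> U" and \<rho>p: "\<rho> p = 0" using assms S by auto
  have F: "(F has_derivative frechet_derivative F (at p)) (at p)"
    using smooth_on_has_derivative[OF assms(4,2,3)] .
  then show "linear (frechet_derivative F (at p))" by (rule has_derivative_linear)
  show "tangent_space \<rho> p = {v. v \<bullet> \<nu> p = 0}" "\<nu> p \<bullet> \<nu> p = 1" using normal[OF assms(1)] by auto
  fix v assume v: "v \<in> tangent_space \<rho> p"
  obtain r where r: "0 < r" "ball p r \<subseteq> W" using assms(2,3) open_contains_ball by blast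
  have f: "(f has_derivative frechet_derivative F (at p)) (at p within S)"
    by (rule has_derivative_transform_within[OF has_derivative_at_withinI[OF F] r(1) assms(1)])
      (use r(2) assms(5) in \<open>auto simp: dist_commute\<close>)
  then have "(f has_derivative frechet_derivative f (at p within S)) (at p within S)"
    using frechet_derivative_works by (auto simp: differentiable_def)
  moreover have "frechet_derivative \<rho> (at p) (gradient \<rho> p) \<noteq> 0"
    using gradient[OF assms(1)] by (simp add: gradient_inner[OF D\<rho>[OF pU]])
  ultimately show "surface_diff S f p v = frechet_derivative F (at p) v"
    using level_set_derivative_unique[OF U(1) pU smooth_on_continuous[OF U(2)] D\<rho>[OF pU] \<rho>p _ _ _ f[unfolded S]] v
    unfolding surface_diff_def tangent_space_def S by blast
qed

text \<open>Unlike \<open>\<nu>\<close>, which is given on \<open>S\<close> and only continuous, the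
  gradient is smooth on \<open>U\<close>. On \<open>S\<close> they differ by a nonzero real factor,
  which the coefficient \<open>b\<close> absorbs.\<close>

lemma qbar_zero_iff_extension:
  assumes "p \<in> S" "open W" "p \<in> W" "smooth_on W F" "\<And>z. z \<in> S \<inter> W \<Longrightarrow> F z = f z"
  shows "f_qbar1 \<rho> S \<nu> f p = 0 \<and> f_qbar2 \<rho> S \<nu> f p = 0 \<longleftrightarrow>
    (\<exists>b. dbar F p = (fst (gradient \<rho> p) * b, snd (gradient \<rho> p) * b))"
proof -
  interpret surface_point \<rho> S \<nu> f p "frechet_derivative F (at p)"
    using assms by (rule surface_point_extension)
  obtain c where c: "c \<noteq> 0" "\<nu> p = c *\<^sub>R gradient \<rho> p" using normal(3)[OF assms(1)] by blast
  have "(\<exists>b. dbar F p = (fst (\<nu> p) * b, snd (\<nu> p) * b)) \<longleftrightarrow>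
    (\<exists>b. dbar F p = (fst (gradient \<rho> p) * b, snd (gradient \<rho> p) * b))" (is "?l \<longleftrightarrow> ?r")
  proof
    assume ?l
    then obtain b where "dbar F p = (fst (\<nu> p) * b, snd (\<nu> p) * b)" by blast
    then show ?r using c by (intro exI[of _ "c *\<^sub>R b"]) simp
  next
    assume ?r
    then obtain b where "dbar F p = (fst (gradient \<rho> p) * b, snd (gradient \<rho> p) * b)" by blast
    then show ?l using c by (intro exI[of _ "inverse c *\<^sub>R b"]) simp
  qed
  then show ?thesis using qbar_zero_iff by (simp add: dbar_dirac)
qed

lemma crf_function_qbar:
  assumes "crf_function U \<rho> S f" "p \<in> S"
  shows "f_qbar1 \<rho> S \<nu> f p = 0 \<and> f_qbar2 \<rho> S \<nu> f p = 0"
proof -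
  obtain V F A B where V: "open V" "S \<subseteq> V" and F: "smooth_on V F" "\<forall>z\<in>S. F z = f z"
    and eq: "\<forall>z\<in>V. dbar F z = \<rho> z *\<^sub>R A z +
           (let R = dbar (\<lambda>w. of_real (\<rho> w)) z in (fst R * B z, snd R * B z))"
    using assms(1) unfolding crf_function_def by blast
  have p: "p \<in> V" "p \<in> U" "\<rho> p = 0" using V assms(2) S by auto
  have "dbar F p = (fst (gradient \<rho> p) * B p, snd (gradient \<rho> p) * B p)"
    using eq p by (simp add: Let_def dbar_of_real[OF D\<rho>])
  then show ?thesis
    using qbar_zero_iff_extension[OF assms(2) V(1) p(1) F(1), of f] F(2) by blast
qed

lemma qbar_crf_function:
  assumes f: "smooth_on_surface S f"
    and qbar: "\<And>p. p \<in> S \<Longrightarrow> f_qbar1 \<rho> S \<nu> f p = 0 \<and> f_qbar2 \<rho> S \<nu> f p = 0"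
  shows "crf_function U \<rho> S f"
proof -
  obtain V0 F where V0: "open V0" "S \<subseteq> V0" and F0: "smooth_on V0 F" and Ff: "\<And>z. z \<in> S \<Longrightarrow> F z = f z"
    using smooth_on_surface_extension[OF f] by blast
  let ?R = "gradient \<rho>"
  have R: "smooth_on U ?R"
    unfolding gradient_def[abs_def]
    by (intro smooth_on_sum smooth_on_scaleR smooth_on_const smooth_on_derivative U)
  \<comment> \<open>The gradient is kept away from 0, since \<open>B\<close> divides by its
    square.\<close>
  define V where "V = V0 \<inter> (U \<inter> ?R -` (- {0}))"
  have V: "open V" "S \<subseteq> V" "V \<subseteq> U" "V \<subseteq> V0"
    using V0 S gradient continuous_open_preimage[OF smooth_on_continuous[OF R] U(1), of "- {0}"]
    by (auto simp: V_def)
  note RV = smooth_on_subset[OF R V(3)] and \<rho>V = smooth_on_subset[OF U(2) V(3)]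
    and FV = smooth_on_subset[OF F0 V(4)]
  have R0: "?R z \<noteq> 0" if "z \<in> V" for z using that by (auto simp: V_def)
  have R1: "smooth_on V (\<lambda>z. fst (?R z))" and R2: "smooth_on V (\<lambda>z. snd (?R z))"
    using smooth_on_bounded_linear[OF V(1) bounded_linear_fst RV] smooth_on_bounded_linear[OF V(1) bounded_linear_snd RV] .
  have dF: "smooth_on V (\<lambda>z. fst (dbar F z))" "smooth_on V (\<lambda>z. snd (dbar F z))"
    using smooth_on_bounded_linear[OF V(1) bounded_linear_fst smooth_on_dbar[OF V(1) FV]]
      smooth_on_bounded_linear[OF V(1) bounded_linear_snd smooth_on_dbar[OF V(1) FV]] .
  have cnj: "bounded_linear qcnj"
    unfolding linear_conv_bounded_linear[symmetric]
    by (rule linearI) (simp_all add: qcnj_def quat_eq_iff plus_quat_def scaleR_quat_def)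
  have RR: "smooth_on V (\<lambda>z. ?R z \<bullet> ?R z)"
    using RV unfolding smooth_on_def by (auto intro: bounded_bilinear.Ck_on[OF bounded_bilinear_inner V(1)])
  define B where "B z = inverse (?R z \<bullet> ?R z) *\<^sub>R qdot (?R z) (dbar F z)" for z
  have B: "smooth_on V B"
    unfolding B_def qdot_def using R0
    by (intro smooth_on_scaleR smooth_on_inverse smooth_on_add smooth_on_mult V(1) RR dF
      smooth_on_bounded_linear[OF V(1) cnj R1] smooth_on_bounded_linear[OF V(1) cnj R2]) simp
  define G where "G z = dbar F z - (fst (?R z) * B z, snd (?R z) * B z)" for z
  have G: "smooth_on V G"
    unfolding G_def
    by (intro smooth_on_diff smooth_on_dbar smooth_on_Pair smooth_on_mult R1 R2 B FV V(1))
  have GS: "G p = 0" if p: "p \<in> S" for p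
  proof -
    have "p \<in> V" using V(2) p by blast
    then obtain b where b: "dbar F p = (fst (?R p) * b, snd (?R p) * b)"
      using qbar_zero_iff_extension[OF p V(1) \<open>p \<in> V\<close> FV, of f] qbar[OF p] Ff by blast
    have "B p = b" using R0[OF \<open>p \<in> V\<close>] unfolding B_def b qdot_self by auto
    then show ?thesis by (simp add: G_def b)
  qed
  \<comment> \<open>A global formula for \<open>G\<close> divided by \<open>\<rho>\<close>, so that
    the local quotients from \<open>smooth_division\<close> need no gluing. Where
    \<open>\<rho>\<close> is 0 the value is forced by differentiating the product of
    \<open>\<rho>\<close> with a local quotient along the gradient.\<close>
  define A where "A z = (if \<rho> z = 0 then inverse (?R z \<bullet> ?R z) *\<^sub>R frechet_derivative G (at z) (?R z)
    else inverse (\<rho> z) *\<^sub>R G z)" for z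
  have A: "smooth_on V A"
  proof (rule smooth_on_local[OF V(1)])
    fix p assume p: "p \<in> V"
    show "\<exists>W. open W \<and> p \<in> W \<and> smooth_on W A"
    proof (cases "\<rho> p = 0")
      case False
      let ?W = "V \<inter> \<rho> -` (- {0})"
      have W: "open ?W" using continuous_open_preimage[OF smooth_on_continuous[OF \<rho>V] V(1)] by blast
      have "smooth_on ?W (\<lambda>z. inverse (\<rho> z) *\<^sub>R G z)"
        using smooth_on_subset[OF \<rho>V, of ?W] smooth_on_subset[OF G, of ?W]
        by (intro smooth_on_scaleR smooth_on_inverse W) auto
      then have "smooth_on ?W A" by (rule smooth_on_cong[OF W, rotated]) (auto simp: A_def)
      then show ?thesis using W False p by blast
    next
      case True
      have "frechet_derivative \<rho> (at p) (?R p) \<noteq> 0"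
        using R0[OF p] V(3) p by (simp add: gradient_inner[OF D\<rho>] subsetD)
      moreover have "G z = 0" if "z \<in> V" "\<rho> z = 0" for z using GS[of z] that V(3) S by auto
      ultimately obtain W' A' where W': "open W'" "p \<in> W'" and A': "smooth_on W' A'" "\<And>z. z \<in> W' \<Longrightarrow> G z = \<rho> z *\<^sub>R A' z"
        using smooth_division[OF V(1) p \<rho>V G True] by blast
      let ?W = "W' \<inter> V"
      have "A' z = A z" if z: "z \<in> ?W" for z
      proof (cases "\<rho> z = 0")
        case False
        then show ?thesis using A'(2)[of z] z by (simp add: A_def)
      next
        case 0: True
        have "((\<lambda>z. \<rho> z *\<^sub>R A' z) has_derivative (\<lambda>v. \<rho> z *\<^sub>R frechet_derivative A' (at z) v + frechet_derivative \<rho> (at z) v *\<^sub>R A' z)) (at z)"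
          using z V(3) by (intro has_derivative_scaleR D\<rho> smooth_on_has_derivative[OF A'(1) W'(1)]) auto
        then have "(G has_derivative (\<lambda>v. \<rho> z *\<^sub>R frechet_derivative A' (at z) v + frechet_derivative \<rho> (at z) v *\<^sub>R A' z)) (at z)"
          by (rule has_derivative_transform_within_open[OF _ W'(1)]) (use z A'(2) in auto)
        then have "frechet_derivative G (at z) (?R z) = (?R z \<bullet> ?R z) *\<^sub>R A' z"
          using 0 z V(3) by (simp add: frechet_derivative_at[symmetric] gradient_inner[OF D\<rho>] subsetD)
        then show ?thesis using 0 R0[of z] z by (simp add: A_def)
      qed
      then have "smooth_on ?W A"
        using W'(1) V(1) smooth_on_subset[OF A'(1), of ?W] by (intro smooth_on_cong[of ?W A' A]) auto
      then show ?thesis using W' p V(1) by blast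
    qed
  qed
  have "dbar F z = \<rho> z *\<^sub>R A z + (let R = dbar (\<lambda>w. of_real (\<rho> w)) z in (fst R * B z, snd R * B z))" if "z \<in> V" for z
  proof -
    have "G z = \<rho> z *\<^sub>R A z"
      using GS[of z] that V(3) S by (cases "\<rho> z = 0") (auto simp: A_def)
    moreover have "dbar (\<lambda>w. of_real (\<rho> w)) z = ?R z" using that V(3) by (intro dbar_of_real D\<rho>) auto
    ultimately show ?thesis by (simp add: G_def Let_def algebra_simps)
  qed
  then show ?thesis
    unfolding crf_function_def using V FV Ff A B by blast
qed

end

theorem theorem2p4:
  fixes U S :: "qpoint set" and \<rho> :: "qpoint \<Rightarrow> real" and \<nu> :: "qpoint \<Rightarrow> qpoint"
    and f :: "qpoint \<Rightarrow> quat"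
  assumes hypersurface: "defining_function U \<rho> S"
    and orientation: "unit_normal_field \<rho> S \<nu>"
    and smooth: "smooth_on_surface S f"
  shows "(crf_function U \<rho> S f \<longleftrightarrow>
            (\<forall>p\<in>S. f_qbar1 \<rho> S \<nu> f p = 0 \<and> f_qbar2 \<rho> S \<nu> f p = 0)) \<and>
         ((\<forall>p\<in>S. f_qbar1 \<rho> S \<nu> f p = 0 \<and> f_qbar2 \<rho> S \<nu> f p = 0) \<longleftrightarrow>
            (\<forall>p\<in>S. form_eq_on (tangent_space \<rho> p) (Dq1 \<and>\<^sub>q d_q1 \<rho> S \<nu> f p) (\<lambda>vs. 0) \<and>
                  form_eq_on (tangent_space \<rho> p) (Dq2 \<and>\<^sub>q d_q2 \<rho> S \<nu> f p) (\<lambda>vs. 0)))"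
proof -
  interpret oriented_hypersurface U S \<rho> \<nu>
    using hypersurface orientation by unfold_locales
  have "f_qbar1 \<rho> S \<nu> f p = 0 \<and> f_qbar2 \<rho> S \<nu> f p = 0 \<longleftrightarrow>
      form_eq_on (tangent_space \<rho> p) (Dq1 \<and>\<^sub>q d_q1 \<rho> S \<nu> f p) (\<lambda>vs. 0) \<and>
      form_eq_on (tangent_space \<rho> p) (Dq2 \<and>\<^sub>q d_q2 \<rho> S \<nu> f p) (\<lambda>vs. 0)" if p: "p \<in> S" for p
  proof -
    obtain W F where "open W" "p \<in> W" "smooth_on W F" "\<forall>z\<in>S \<inter> W. F z = f z"
      using smooth p unfolding smooth_on_surface_def by metis
    then have "surface_point \<rho> S \<nu> f p (frechet_derivative F (at p))"
      using surface_point_extension[OF p] by blast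
    then show ?thesis by (rule surface_point.qbar_zero_iff_dirac_forms)
  qed
  then show ?thesis using crf_function_qbar qbar_crf_function[OF smooth] by blast
qed

end
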